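(* Let $\mathcal{A}$ be a central and essential arrangement in $\mathbb{Q}^l$ as in the context, $\sigma$ a term ordering, and $p$ a prime that is good and $(\sigma,l)$-lucky for $\mathcal{A}$. Let $q$ be a power of $p$. Then $$\overline{\chi}_{\mathcal{A}}(q,t)=\sum_{P\in\mathbb{F}_q^l}t^{h(P)},$$ where $h(P)$ is the number of hyperplanes of $\mathcal{A}_{\mathbb{F}_q}$ containing $P$.
   Context: $\mathcal{A}=\{H_1,\dots,H_n\}$: $n$ distinct linear hyperplanes in $\mathbb{Q}^l$ with $\bigcap H_i=\{0\}$, $H_i=\{\alpha_i=0\}$, $\alpha_i\in\mathbb{Z}[x_1,\dots,x_l]$ a nonzero linear form whose coefficients are not all divisible by any prime, $Q(\mathcal{A})=\prod\alpha_i$. $p$ is good if the reduction of $Q(\mathcal{A})$ mod $p$ is reduced (no reduction $(\alpha_i)_p$ is a scalar multiple of $(\alpha_j)_p$, $i<j$). $\mathcal{A}_{\mathbb{F}_q}$ is the arrangement in $\mathbb{F}_q^l$ defined by the image of $Q(\mathcal{A})$ in $\mathbb{F}_q[x_1,\dots,x_l]$, i.e. the hyperplanes $\{\bar\alpha_i=0\}$. For a term ordering $\sigma$ and nonzero $f\in\mathbb{Z}[x_1,\dots,x_l]$, $\mathrm{LM}_\sigma(f)$ is the $\sigma$-leading term times its coefficient $\mathrm{LC}_\sigma(f)$. A minimal strong $\sigma$-Gröbner basis of an ideal $I\subseteq\mathbb{Z}[x_1,\dots,x_l]$ is a finite generating set $G$ of nonzero elements of $I$ such that every nonzero $f\in I$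 has $\mathrm{LM}_\sigma(f)$ divisible by some $\mathrm{LM}_\sigma(g)$, $g\in G$, and no $\mathrm{LM}_\sigma(g)$ divides $\mathrm{LM}_\sigma(g')$ for distinct $g,g'$; its set of leading coefficients is independent of the choice. $p$ is $\sigma$-lucky for $I$ if it divides none of these leading coefficients; $p$ is $(\sigma,l)$-lucky for $\mathcal{A}$ if it is $\sigma$-lucky for every ideal $\langle\alpha_{i_1},\dots,\alpha_{i_l}\rangle$ with $i_1<\dots<i_l$ and $\operatorname{codim}(H_{i_1}\cap\dots\cap H_{i_l})=l$. The coboundary polynomial is $\overline{\chi}_{\mathcal{A}}(x,y)=\sum_{\mathcal{B}\subseteq\mathcal{A}}x^{\mathrm{rk}(\mathcal{A})-\mathrm{rk}(\mathcal{B})}(y-1)^{|\mathcal{B}|}$, where $\mathrm{rk}(\mathcal{B})=\operatorname{codim}\bigcap_{H\in\mathcal{B}}H$ (the sum is over all subsets since $\mathcal{A}$ is central). *)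

theory Defs
  imports Main "HOL-Library.Poly_Mapping" "HOL-Library.Function_Algebras" "HOL-Computational_Algebra.Polynomial"
    "HOL-Computational_Algebra.Primes"
begin

text \<open>The arrangement A = {H_0,...,H_(n-1)} in Q^l is given by a coefficient function
  a :: nat => nat => int, alpha_i = sum_(k<l) a i k * x_k (i < n).
  Vectors of Q^l (resp. F_q^l) are functions nat => field vanishing from index l on.\<close>

definition vecs :: "nat \<Rightarrow> (nat \<Rightarrow> 'a::zero) set" where
  "vecs l = {x. \<forall>k\<ge>l. x k = 0}"

definition lform :: "nat \<Rightarrow> (nat \<Rightarrow> nat \<Rightarrow> int) \<Rightarrow> nat \<Rightarrow> (nat \<Rightarrow> 'a::ring_1) \<Rightarrow> 'a" where
  "lform l a i x = (\<Sum>k<l. of_int (a i k) * x k)"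

definition hyperplane :: "nat \<Rightarrow> (nat \<Rightarrow> nat \<Rightarrow> int) \<Rightarrow> nat \<Rightarrow> (nat \<Rightarrow> 'a::ring_1) set" where
  "hyperplane l a i = {x \<in> vecs l. lform l a i x = 0}"

definition arrangement :: "nat \<Rightarrow> nat \<Rightarrow> (nat \<Rightarrow> nat \<Rightarrow> int) \<Rightarrow> bool" where
  "arrangement l n a \<longleftrightarrow>
     (\<forall>i<n. \<exists>k<l. a i k \<noteq> 0) \<and>
     (\<forall>i<n. \<forall>p::int. prime p \<longrightarrow> \<not> (\<forall>k<l. p dvd a i k)) \<and>
     (\<forall>i<n. \<forall>j<n. i \<noteq> j \<longrightarrow>
        (hyperplane l a i :: (nat \<Rightarrow> rat) set) \<noteq> hyperplane l a j)"

definition essential :: "nat \<Rightarrow> nat \<Rightarrow> (nat \<Rightarrow> nat \<Rightarrow> int) \<Rightarrow> bool" where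
  "essential l n a \<longleftrightarrow> vecs l \<inter> (\<Inter>i<n. hyperplane l a i) = {(\<lambda>_. 0) :: nat \<Rightarrow> rat}"

definition qdim :: "(nat \<Rightarrow> rat) set \<Rightarrow> nat" where
  "qdim = Vector_Spaces.vector_space.dim (\<lambda>(c::rat) (v::nat \<Rightarrow> rat) k. c * v k)"

definition rk :: "nat \<Rightarrow> (nat \<Rightarrow> nat \<Rightarrow> int) \<Rightarrow> nat set \<Rightarrow> nat" where
  "rk l a B = l - qdim (vecs l \<inter> (\<Inter>i\<in>B. hyperplane l a i))"

text \<open>Coboundary polynomial evaluated at x = q, as a polynomial in y (= t).\<close>
definition coboundary_at :: "nat \<Rightarrow> nat \<Rightarrow> (nat \<Rightarrow> nat \<Rightarrow> int) \<Rightarrow> int \<Rightarrow> int poly" where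
  "coboundary_at l n a x = (\<Sum>B\<in>Pow {..<n}.
      [:x:] ^ (rk l a {..<n} - rk l a B) * [:-1, 1:] ^ card B)"

definition good_prime :: "nat \<Rightarrow> nat \<Rightarrow> (nat \<Rightarrow> nat \<Rightarrow> int) \<Rightarrow> nat \<Rightarrow> bool" where
  "good_prime l n a p \<longleftrightarrow> (\<forall>i j. i < j \<and> j < n \<longrightarrow>
      \<not> (\<exists>c::int. \<forall>k<l. int p dvd (a i k - c * a j k)))"

type_synonym monom = "nat \<Rightarrow>\<^sub>0 nat"
type_synonym ipoly = "monom \<Rightarrow>\<^sub>0 int"

definition monoms :: "nat \<Rightarrow> monom set" where
  "monoms l = {m. Poly_Mapping.keys m \<subseteq> {..<l}}"

definition polys :: "nat \<Rightarrow> ipoly set" where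
  "polys l = {f. Poly_Mapping.keys f \<subseteq> monoms l}"

definition linpoly :: "nat \<Rightarrow> (nat \<Rightarrow> nat \<Rightarrow> int) \<Rightarrow> nat \<Rightarrow> ipoly" where
  "linpoly l a i = (\<Sum>k<l. Poly_Mapping.single (Poly_Mapping.single k 1) (a i k))"

definition gen_ideal :: "nat \<Rightarrow> ipoly set \<Rightarrow> ipoly set" where
  "gen_ideal l G = {f. \<exists>S c. finite S \<and> S \<subseteq> G \<and> (\<forall>g\<in>S. c g \<in> polys l) \<and>
                         f = (\<Sum>g\<in>S. c g * g)}"

definition term_order :: "nat \<Rightarrow> (monom \<Rightarrow> monom \<Rightarrow> bool) \<Rightarrow> bool" where
  "term_order l le \<longleftrightarrow>
     (\<forall>m\<in>monoms l. le m m) \<and>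
     (\<forall>m1\<in>monoms l. \<forall>m2\<in>monoms l. le m1 m2 \<and> le m2 m1 \<longrightarrow> m1 = m2) \<and>
     (\<forall>m1\<in>monoms l. \<forall>m2\<in>monoms l. \<forall>m3\<in>monoms l. le m1 m2 \<and> le m2 m3 \<longrightarrow> le m1 m3) \<and>
     (\<forall>m1\<in>monoms l. \<forall>m2\<in>monoms l. le m1 m2 \<or> le m2 m1) \<and>
     (\<forall>m\<in>monoms l. le 0 m) \<and>
     (\<forall>m1\<in>monoms l. \<forall>m2\<in>monoms l. \<forall>m\<in>monoms l. le m1 m2 \<longrightarrow> le (m1 + m) (m2 + m))"

definition lexp :: "(monom \<Rightarrow> monom \<Rightarrow> bool) \<Rightarrow> ipoly \<Rightarrow> monom" where
  "lexp le f = (THE m. m \<in> Poly_Mapping.keys f \<and> (\<forall>m'\<in>Poly_Mapping.keys f. le m' m))"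

definition lcoeff :: "(monom \<Rightarrow> monom \<Rightarrow> bool) \<Rightarrow> ipoly \<Rightarrow> int" where
  "lcoeff le f = Poly_Mapping.lookup f (lexp le f)"

definition lm_dvd :: "(monom \<Rightarrow> monom \<Rightarrow> bool) \<Rightarrow> ipoly \<Rightarrow> ipoly \<Rightarrow> bool" where
  "lm_dvd le g f \<longleftrightarrow> (\<forall>k. Poly_Mapping.lookup (lexp le g) k \<le> Poly_Mapping.lookup (lexp le f) k) \<and>
                       lcoeff le g dvd lcoeff le f"

definition min_strong_gb :: "nat \<Rightarrow> (monom \<Rightarrow> monom \<Rightarrow> bool) \<Rightarrow> ipoly set \<Rightarrow> ipoly set \<Rightarrow> bool" where
  "min_strong_gb l le I G \<longleftrightarrow>
     finite G \<and> G \<subseteq> I - {0} \<and> gen_ideal l G = I \<and>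
     (\<forall>f\<in>I. f \<noteq> 0 \<longrightarrow> (\<exists>g\<in>G. lm_dvd le g f)) \<and>
     (\<forall>g\<in>G. \<forall>g'\<in>G. g \<noteq> g' \<longrightarrow> \<not> lm_dvd le g g')"

definition lucky :: "nat \<Rightarrow> (monom \<Rightarrow> monom \<Rightarrow> bool) \<Rightarrow> ipoly set \<Rightarrow> nat \<Rightarrow> bool" where
  "lucky l le I p \<longleftrightarrow> (\<forall>G. min_strong_gb l le I G \<longrightarrow> (\<forall>g\<in>G. \<not> int p dvd lcoeff le g))"

definition arr_lucky :: "nat \<Rightarrow> nat \<Rightarrow> (nat \<Rightarrow> nat \<Rightarrow> int) \<Rightarrow> (monom \<Rightarrow> monom \<Rightarrow> bool) \<Rightarrow> nat \<Rightarrow> bool" where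
  "arr_lucky l n a le p \<longleftrightarrow> (\<forall>S. S \<subseteq> {..<n} \<and> card S = l \<and> rk l a S = l \<longrightarrow>
      lucky l le (gen_ideal l (linpoly l a ` S)) p)"

definition hcount :: "nat \<Rightarrow> nat \<Rightarrow> (nat \<Rightarrow> nat \<Rightarrow> int) \<Rightarrow> (nat \<Rightarrow> 'k::ring_1) \<Rightarrow> nat" where
  "hcount l n a P = card {H \<in> hyperplane l a ` {..<n}. P \<in> H}"

end

theory Submission
  imports Defs "HOL-Library.FuncSet"
begin

text \<open>Expanding t^h(P) = ((t - 1) + 1)^h(P) over the subsets of the hyperplanes through P and
  exchanging the sums reduces the claim to showing that, for every set B of hyperplanes, the rank
  of B over the rationals equals its rank over the finite field. For a set S of l forms independent
  over the rationals, every variable is the leading monomial of an element of a minimal strong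
  Groebner basis of the ideal of S; luckiness makes the leading coefficient nonzero modulo p, so the
  linear parts of these elements show that S has no nontrivial common zero over the finite field.
  An arbitrary B is then handled by choosing S to contain a maximal independent subset of B. Since
  luckiness quantifies over all minimal strong bases, the existence of one (Dickson's lemma) is an
  essential ingredient.\<close>

section \<open>Minimal strong Groebner bases over the integers\<close>

text \<open>Two things could go wrong with ranks modulo p. Independent forms might become dependent:
  luckiness forbids this, but it speaks only of sets of exactly \<open>l\<close> independent forms,
  so a smaller independent set has to be completed first, which is possible because the arrangement
  is essential. Conversely, a form that depends on others over the rationals must still do so modulo
  p: clearing denominators puts an integer multiplier in front of it, and this multiplier has to be
  made prime to p. Goodness serves the count h(P): it counts hyperplanes as sets while the expansion
  runs over sets of indices, and the two agree because distinct indices give distinct hyperplanes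
  over the finite field.

  Leading coefficients in the integers are not units, so the basis construction tracks divisibility
  of coefficients along with that of monomials. The exponents in a minimal strong basis need not be
  minimal for divisibility: in the ideal generated by 4 and 2x both generators are kept.\<close>

lemma monotone_subsequence:
  fixes f :: "nat \<Rightarrow> nat \<Rightarrow> nat"
  shows "\<exists>r::nat \<Rightarrow> nat. strict_mono r \<and> (\<forall>k<l. mono (\<lambda>i. f (r i) k))"
proof (induction l)
  case 0
  have "strict_mono (id :: nat \<Rightarrow> nat)" by (simp add: strict_mono_def)
  then show ?case by blast
next
  case (Suc l)
  then obtain r :: "nat \<Rightarrow> nat" where r: "strict_mono r" "\<forall>k<l. mono (\<lambda>i. f (r i) k)" by blast
  obtain s :: "nat \<Rightarrow> nat" where s: "strict_mono s" "mono (\<lambda>i. f (r (s i)) l)"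
  proof -
    define h where "h = (\<lambda>i. f (r i) l)"
    \<comment> \<open>\<open>peak N\<close> is a position where \<open>h\<close> attains its minimum
      on the tail from \<open>N\<close>. Iterating it picks terms that are at most everything after
      them, hence a nondecreasing sequence.\<close>
    define peak where "peak N = (LEAST m. N \<le> m \<and> (\<forall>j\<ge>N. h m \<le> h j))" for N
    have peak: "N \<le> peak N \<and> (\<forall>j\<ge>N. h (peak N) \<le> h j)" for N
    proof -
      have "\<exists>m. N \<le> m \<and> (\<forall>j. N \<le> j \<longrightarrow> h m \<le> h j)"
        using ex_has_least_nat[of "\<lambda>j. N \<le> j" N h] by auto
      then show ?thesis unfolding peak_def by (rule LeastI_ex)
    qed
    define s where "s = rec_nat (peak 0) (\<lambda>_ m. peak (Suc m))"
    have s_Suc: "s (Suc i) = peak (Suc (s i))" for i by (simp add: s_def)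
    have "s i < s (Suc i)" for i using peak[of "Suc (s i)"] by (simp add: s_Suc)
    then have sm: "strict_mono s" by (simp add: strict_mono_Suc_iff)
    have "h (s i) \<le> h j" if "j \<ge> s i" for i j
    proof (cases i)
      case 0
      then show ?thesis using peak[of 0] by (simp add: s_def)
    next
      case (Suc i')
      then have "Suc (s i') \<le> j" using that sm[THEN strict_monoD, of i' i] by simp
      then show ?thesis using peak Suc s_Suc by simp
    qed
    then have "mono (\<lambda>i. f (r (s i)) l)"
      using sm by (intro monoI) (simp add: h_def strict_mono_less_eq)
    then show ?thesis using that sm by blast
  qed
  have sub: "strict_mono (r \<circ> s)" using r s by (simp add: strict_mono_o)
  have "mono (\<lambda>i. f ((r \<circ> s) i) k)" if "k < Suc l" for k
  proof (cases "k = l")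
    case False
    then have "mono (\<lambda>i. f (r i) k)" using r that by simp
    from monoD[OF this] show ?thesis using s(1)
      by (intro monoI) (simp add: strict_mono_less_eq)
  qed (use s in simp)
  then show ?case using sub by (intro exI[of _ "r \<circ> s"] conjI) (assumption, simp)
qed

text \<open>Exponents vanish from index \<open>l\<close> on, so finitely many monotone coordinates
  suffice. A whole divisibility chain, rather than one divisible pair, is what the finiteness of the
  basis will need.\<close>

lemma dickson:
  assumes "\<And>i. m i \<in> monoms l"
  shows "\<exists>r::nat \<Rightarrow> nat. strict_mono r \<and>
    (\<forall>i j. i \<le> j \<longrightarrow> (\<forall>k. Poly_Mapping.lookup (m (r i)) k \<le> Poly_Mapping.lookup (m (r j)) k))"
proof -
  obtain r :: "nat \<Rightarrow> nat" where r: "strict_mono r" "\<forall>k<l. mono (\<lambda>i. Poly_Mapping.lookup (m (r i)) k)"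
    using monotone_subsequence[of l "\<lambda>i. Poly_Mapping.lookup (m i)"] by blast
  have "Poly_Mapping.lookup (m (r i)) k \<le> Poly_Mapping.lookup (m (r j)) k" if "i \<le> j" for i j k
  proof (cases "k < l")
    case True
    then show ?thesis using r(2) that by (auto dest: monoD)
  next
    case False
    then have "k \<notin> Poly_Mapping.keys (m (r i))" using assms[of "r i"] by (auto simp: monoms_def)
    then show ?thesis by (simp add: in_keys_iff)
  qed
  then show ?thesis using r by blast
qed

section \<open>Polynomials in the first l variables and their ideals\<close>

lemma monoms_zero: "0 \<in> monoms l"
  by (simp add: monoms_def)

lemma monoms_add: "m \<in> monoms l \<Longrightarrow> m' \<in> monoms l \<Longrightarrow> m + m' \<in> monoms l"
  using keys_add[of m m'] by (auto simp: monoms_def)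

lemma monoms_minus: "m \<in> monoms l \<Longrightarrow> m - m' \<in> monoms l"
  by (auto simp: monoms_def in_keys_iff lookup_minus subset_iff)

lemma monoms_single: "k < l \<Longrightarrow> Poly_Mapping.single k c \<in> monoms l"
  by (auto simp: monoms_def)

lemma monom_minus_add:
  fixes m m' :: monom
  assumes "\<And>k. Poly_Mapping.lookup m k \<le> Poly_Mapping.lookup m' k"
  shows "(m' - m) + m = m'"
  using assms by (intro poly_mapping_eqI) (simp add: lookup_add lookup_minus)

lemma polys_zero: "0 \<in> polys l"
  by (simp add: polys_def)

lemma polys_add: "f \<in> polys l \<Longrightarrow> g \<in> polys l \<Longrightarrow> f + g \<in> polys l"
  using keys_add[of f g] by (auto simp: polys_def)

lemma polys_mult: "f \<in> polys l \<Longrightarrow> g \<in> polys l \<Longrightarrow> f * g \<in> polys l"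
  using keys_mult[of f g] by (force simp: polys_def intro: monoms_add)

lemma polys_single: "m \<in> monoms l \<Longrightarrow> Poly_Mapping.single m c \<in> polys l"
  by (auto simp: polys_def)

lemma polys_sum: "(\<And>i. i \<in> A \<Longrightarrow> f i \<in> polys l) \<Longrightarrow> (\<Sum>i\<in>A. f i) \<in> polys l"
  by (induction A rule: infinite_finite_induct) (auto intro: polys_zero polys_add)

text \<open>Adding \<open>u\<close> is injective on exponents, so exactly one term of
  \<open>f\<close> contributes. Building \<open>f\<close> term by term avoids the convolution in the
  definition of the product.\<close>

lemma lookup_single_mult:
  fixes f :: ipoly
  shows "Poly_Mapping.lookup (Poly_Mapping.single u c * f) (u + m) = c * Poly_Mapping.lookup f m"
proof (induction f rule: update_induct)
  case const
  then show ?case by simp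
next
  case (update f a b)
  have "Poly_Mapping.update a b f = f + Poly_Mapping.single a b"
    using update by (intro poly_mapping_eqI)
      (auto simp: lookup_update lookup_add lookup_single in_keys_iff when_def)
  then show ?case using update
    by (simp add: distrib_left mult_single lookup_add lookup_single when_def)
qed

text \<open>The type \<open>ipoly\<close> has infinitely many variables; multipliers are restricted
  to \<open>polys l\<close> so that this is an ideal of the polynomial ring in \<open>l\<close>
  variables.\<close>

definition poly_ideal :: "nat \<Rightarrow> ipoly set \<Rightarrow> bool" where
  "poly_ideal l I \<longleftrightarrow> I \<subseteq> polys l \<and> 0 \<in> I \<and> (\<forall>f\<in>I. \<forall>g\<in>I. f + g \<in> I) \<and>
     (\<forall>c\<in>polys l. \<forall>f\<in>I. c * f \<in> I)"

lemma poly_ideal_sum: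
  "poly_ideal l I \<Longrightarrow> (\<And>i. i \<in> A \<Longrightarrow> f i \<in> I) \<Longrightarrow> (\<Sum>i\<in>A. f i) \<in> I"
  by (induction A rule: infinite_finite_induct) (auto simp: poly_ideal_def)

lemma gen_ideal_mult:
  assumes "f \<in> gen_ideal l G" "d \<in> polys l"
  shows "d * f \<in> gen_ideal l G"
proof -
  obtain S c where S: "finite S" "S \<subseteq> G" "\<forall>g\<in>S. c g \<in> polys l" "f = (\<Sum>g\<in>S. c g * g)"
    using assms(1) by (auto simp: gen_ideal_def)
  then have "d * f = (\<Sum>g\<in>S. (d * c g) * g)" by (simp add: sum_distrib_left mult.assoc)
  moreover have "\<forall>g\<in>S. d * c g \<in> polys l" using S assms(2) polys_mult by blast
  ultimately show ?thesis using S(1,2) unfolding gen_ideal_def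
    by (intro CollectI exI[of _ S] exI[of _ "\<lambda>g. d * c g"]) simp
qed

lemma gen_ideal_add:
  assumes "f \<in> gen_ideal l G" "f' \<in> gen_ideal l G"
  shows "f + f' \<in> gen_ideal l G"
proof -
  obtain S c where S: "finite S" "S \<subseteq> G" "\<forall>g\<in>S. c g \<in> polys l" "f = (\<Sum>g\<in>S. c g * g)"
    using assms(1) by (auto simp: gen_ideal_def)
  obtain T d where T: "finite T" "T \<subseteq> G" "\<forall>g\<in>T. d g \<in> polys l" "f' = (\<Sum>g\<in>T. d g * g)"
    using assms(2) by (auto simp: gen_ideal_def)
  \<comment> \<open>The two representations use different finite sets of generators; padding the
    cofactors with 0 puts both on the union.\<close>
  let ?c = "\<lambda>g. if g \<in> S then c g else 0" and ?d = "\<lambda>g. if g \<in> T then d g else 0"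
  have "f = (\<Sum>g\<in>S \<union> T. ?c g * g)" unfolding S(4) using S T
    by (intro sum.mono_neutral_cong_left) auto
  moreover have "f' = (\<Sum>g\<in>S \<union> T. ?d g * g)" unfolding T(4) using S T
    by (intro sum.mono_neutral_cong_left) auto
  ultimately have "f + f' = (\<Sum>g\<in>S \<union> T. (?c g + ?d g) * g)"
    by (simp only: distrib_right sum.distrib)
  moreover have "\<forall>g\<in>S \<union> T. ?c g + ?d g \<in> polys l" using S T polys_zero polys_add by auto
  ultimately show ?thesis using S(1,2) T(1,2) unfolding gen_ideal_def
    by (intro CollectI exI[of _ "S \<union> T"] exI[of _ "\<lambda>g. ?c g + ?d g"]) auto
qed

lemma gen_ideal_zero: "0 \<in> gen_ideal l G"
  unfolding gen_ideal_def by (intro CollectI exI[of _ "{}"] exI[of _ "\<lambda>_. 0"]) simp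

lemma gen_ideal_base: "g \<in> G \<Longrightarrow> g \<in> gen_ideal l G"
  unfolding gen_ideal_def
  by (intro CollectI exI[of _ "{g}"] exI[of _ "\<lambda>_. 1"]) (auto simp: polys_def monoms_def)

lemma poly_ideal_gen_ideal:
  assumes "G \<subseteq> polys l"
  shows "poly_ideal l (gen_ideal l G)"
proof -
  have "gen_ideal l G \<subseteq> polys l"
    using assms by (auto simp: gen_ideal_def intro!: polys_sum polys_mult)
  then show ?thesis using gen_ideal_zero gen_ideal_add gen_ideal_mult
    by (auto simp: poly_ideal_def)
qed

lemma gen_ideal_least: "poly_ideal l I \<Longrightarrow> G \<subseteq> I \<Longrightarrow> gen_ideal l G \<subseteq> I"
  by (auto simp: gen_ideal_def intro!: poly_ideal_sum) (auto simp: poly_ideal_def)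

lemma lm_dvd_trans: "lm_dvd le f g \<Longrightarrow> lm_dvd le g h \<Longrightarrow> lm_dvd le f h"
  unfolding lm_dvd_def by (meson order_trans dvd_trans)

section \<open>Leading terms for a fixed term ordering\<close>

context
  fixes l :: nat and le :: "monom \<Rightarrow> monom \<Rightarrow> bool"
  assumes order: "term_order l le"
begin

lemma
  shows le_refl: "m \<in> monoms l \<Longrightarrow> le m m"
    and le_antisym: "m \<in> monoms l \<Longrightarrow> m' \<in> monoms l \<Longrightarrow> le m m' \<Longrightarrow> le m' m \<Longrightarrow> m = m'"
    and le_trans: "m \<in> monoms l \<Longrightarrow> m' \<in> monoms l \<Longrightarrow> m'' \<in> monoms l \<Longrightarrow>
      le m m' \<Longrightarrow> le m' m'' \<Longrightarrow> le m m''"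
    and le_total: "m \<in> monoms l \<Longrightarrow> m' \<in> monoms l \<Longrightarrow> le m m' \<or> le m' m"
    and le_zero: "m \<in> monoms l \<Longrightarrow> le 0 m"
    and le_add_mono: "m \<in> monoms l \<Longrightarrow> m' \<in> monoms l \<Longrightarrow> u \<in> monoms l \<Longrightarrow>
      le m m' \<Longrightarrow> le (m + u) (m' + u)"
proof -
  note ord = order[unfolded term_order_def]
  show "m \<in> monoms l \<Longrightarrow> le m m"
    using ord[THEN conjunct1] by blast
  show "m \<in> monoms l \<Longrightarrow> m' \<in> monoms l \<Longrightarrow> le m m' \<Longrightarrow> le m' m \<Longrightarrow> m = m'"
    using ord[THEN conjunct2, THEN conjunct1] by blast
  note ord = ord[THEN conjunct2, THEN conjunct2]
  show "m \<in> monoms l \<Longrightarrow> m' \<in> monoms l \<Longrightarrow> m'' \<in> monoms l \<Longrightarrow> le m m' \<Longrightarrow> le m' m'' \<Longrightarrow> le m m''"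
    using ord[THEN conjunct1] by blast
  note ord = ord[THEN conjunct2]
  show "m \<in> monoms l \<Longrightarrow> m' \<in> monoms l \<Longrightarrow> le m m' \<or> le m' m"
    using ord[THEN conjunct1] by blast
  note ord = ord[THEN conjunct2]
  show "m \<in> monoms l \<Longrightarrow> le 0 m"
    using ord[THEN conjunct1] by blast
  show "m \<in> monoms l \<Longrightarrow> m' \<in> monoms l \<Longrightarrow> u \<in> monoms l \<Longrightarrow> le m m' \<Longrightarrow> le (m + u) (m' + u)"
    using ord[THEN conjunct2] by blast
qed

lemma le_if_dvd:
  assumes "m \<in> monoms l" "m' \<in> monoms l"
    and "\<And>k. Poly_Mapping.lookup m k \<le> Poly_Mapping.lookup m' k"
  shows "le m m'"
proof -
  have "m' - m \<in> monoms l" using assms(2) by (rule monoms_minus)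
  then have "le (0 + m) ((m' - m) + m)"
    using assms(1) monoms_zero le_zero by (intro le_add_mono)
  then show ?thesis using monom_minus_add[OF assms(3)] by simp
qed

text \<open>By Dickson, an infinite descending chain contains an earlier monomial dividing a later
  one; divisibility makes the earlier one the smaller, against strict descent.\<close>

lemma wf_term_order: "wf {(m, m'). m \<in> monoms l \<and> m' \<in> monoms l \<and> le m m' \<and> m \<noteq> m'}"
proof (rule ccontr)
  assume "\<not> ?thesis"
  then obtain m where m: "\<And>i. m (Suc i) \<in> monoms l \<and> m i \<in> monoms l \<and> le (m (Suc i)) (m i) \<and> m (Suc i) \<noteq> m i"
    unfolding wf_iff_no_infinite_down_chain by auto
  have desc: "i < j \<Longrightarrow> le (m j) (m i) \<and> m j \<noteq> m i" for i j
  proof (induction j)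
    case (Suc j)
    show ?case
    proof (cases "i = j")
      case False
      then have "le (m j) (m i)" "m j \<noteq> m i" using Suc by auto
      then show ?thesis using m[of j] m[of i] le_trans[of "m (Suc j)" "m j" "m i"]
          le_antisym[of "m j" "m i"] by metis
    qed (use m[of j] in auto)
  qed simp
  obtain r :: "nat \<Rightarrow> nat" where r: "strict_mono r"
    "\<And>i j k. i \<le> j \<Longrightarrow> Poly_Mapping.lookup (m (r i)) k \<le> Poly_Mapping.lookup (m (r j)) k"
    using dickson[of m l] m by blast
  have "r 0 < r 1" using r(1) by (simp add: strict_mono_def)
  moreover have "le (m (r 0)) (m (r 1))" using r(2)[of 0 1] m by (intro le_if_dvd) auto
  ultimately show False using desc[of "r 0" "r 1"] m le_antisym by blast
qed

lemma lexp_eqI: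
  assumes "f \<in> polys l" "Poly_Mapping.lookup f m \<noteq> 0" "\<And>m'. m' \<in> Poly_Mapping.keys f \<Longrightarrow> le m' m"
  shows "lexp le f = m"
  unfolding lexp_def
proof (rule the_equality)
  show "m \<in> Poly_Mapping.keys f \<and> (\<forall>m'\<in>Poly_Mapping.keys f. le m' m)" using assms by (simp add: in_keys_iff)
  fix m' assume "m' \<in> Poly_Mapping.keys f \<and> (\<forall>m''\<in>Poly_Mapping.keys f. le m'' m')"
  then have "m \<in> monoms l" "m' \<in> monoms l" "le m m'" "le m' m"
    using assms by (auto simp: polys_def in_keys_iff subset_iff)
  then show "m' = m" using le_antisym by blast
qed

lemma finite_max_exists:
  assumes "finite A" "A \<noteq> {}" "A \<subseteq> monoms l"
  shows "\<exists>m\<in>A. \<forall>m'\<in>A. le m' m"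
  using assms
proof (induction A rule: finite_ne_induct)
  case (singleton x)
  then show ?case using le_refl by simp
next
  case (insert x F)
  then obtain m where m: "m \<in> F" "\<forall>m'\<in>F. le m' m" by auto
  show ?case
  proof (cases "le x m")
    case False
    then have "le m x" using insert m le_total by blast
    then have "\<forall>m'\<in>F. le m' x" using insert m by (blast intro: le_trans)
    then show ?thesis using insert le_refl by auto
  qed (use m in auto)
qed

lemma
  assumes "f \<in> polys l" "f \<noteq> 0"
  shows lexp_monoms: "lexp le f \<in> monoms l"
    and lcoeff_nonzero: "lcoeff le f \<noteq> 0"
    and lexp_max: "m \<in> Poly_Mapping.keys f \<Longrightarrow> le m (lexp le f)"
proof -
  obtain m where m: "m \<in> Poly_Mapping.keys f" "\<forall>m'\<in>Poly_Mapping.keys f. le m' m"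
    using finite_max_exists[of "Poly_Mapping.keys f"] assms by (auto simp: polys_def)
  then have "lexp le f = m" using assms by (intro lexp_eqI) (auto simp: in_keys_iff)
  then show "lexp le f \<in> monoms l" "lcoeff le f \<noteq> 0" "m' \<in> Poly_Mapping.keys f \<Longrightarrow> le m' (lexp le f)" for m'
    using m assms by (auto simp: lcoeff_def polys_def in_keys_iff)
qed

lemma
  assumes "g \<in> polys l" "g \<noteq> 0" "u \<in> monoms l" "c \<noteq> 0"
  shows lexp_single_mult: "lexp le (Poly_Mapping.single u c * g) = u + lexp le g"
    and lcoeff_single_mult: "lcoeff le (Poly_Mapping.single u c * g) = c * lcoeff le g"
proof -
  have "Poly_Mapping.lookup (Poly_Mapping.single u c * g) (u + lexp le g) = c * lcoeff le g"
    by (simp add: lookup_single_mult lcoeff_def)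
  moreover have "lexp le (Poly_Mapping.single u c * g) = u + lexp le g"
  proof (rule lexp_eqI)
    show "Poly_Mapping.single u c * g \<in> polys l" using assms by (simp add: polys_mult polys_single)
    show "Poly_Mapping.lookup (Poly_Mapping.single u c * g) (u + lexp le g) \<noteq> 0"
      using assms lcoeff_nonzero by (simp add: lookup_single_mult lcoeff_def)
    fix m' assume "m' \<in> Poly_Mapping.keys (Poly_Mapping.single u c * g)"
    then obtain m where m: "m' = u + m" "m \<in> Poly_Mapping.keys g"
      using keys_mult[of "Poly_Mapping.single u c" g] assms by auto
    moreover have "m \<in> monoms l" using m(2) assms(1) by (auto simp: polys_def)
    ultimately show "le m' (u + lexp le g)"
      using le_add_mono[OF _ lexp_monoms[OF assms(1,2)] assms(3) lexp_max[OF assms(1,2)]]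
      by (simp add: add.commute)
  qed
  ultimately show "lexp le (Poly_Mapping.single u c * g) = u + lexp le g"
    "lcoeff le (Poly_Mapping.single u c * g) = c * lcoeff le g" by (simp_all add: lcoeff_def)
qed

text \<open>The first case serves division with remainder of leading coefficients, the second serves
  reduction, where the leading terms cancel.\<close>

lemma lexp_add_same:
  assumes "f \<in> polys l" "g \<in> polys l" "f \<noteq> 0" "g \<noteq> 0" "lexp le f = lexp le g"
  shows "lcoeff le f + lcoeff le g \<noteq> 0 \<Longrightarrow>
      f + g \<noteq> 0 \<and> lexp le (f + g) = lexp le f \<and> lcoeff le (f + g) = lcoeff le f + lcoeff le g"
    and "lcoeff le f + lcoeff le g = 0 \<Longrightarrow> f + g \<noteq> 0 \<Longrightarrow>
      le (lexp le (f + g)) (lexp le f) \<and> lexp le (f + g) \<noteq> lexp le f"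
proof -
  have lk: "Poly_Mapping.lookup (f + g) (lexp le f) = lcoeff le f + lcoeff le g"
    using assms(5) by (simp add: lookup_add lcoeff_def)
  have pol: "f + g \<in> polys l" using assms by (simp add: polys_add)
  have bd: "le m (lexp le f)" if "m \<in> Poly_Mapping.keys (f + g)" for m
    using that keys_add[of f g] lexp_max[of f m] lexp_max[of g m] assms by auto
  show "f + g \<noteq> 0 \<and> lexp le (f + g) = lexp le f \<and> lcoeff le (f + g) = lcoeff le f + lcoeff le g"
    if "lcoeff le f + lcoeff le g \<noteq> 0"
    using lexp_eqI[OF pol _ bd] that lk by (auto simp: lcoeff_def)
  show "le (lexp le (f + g)) (lexp le f) \<and> lexp le (f + g) \<noteq> lexp le f"
    if "lcoeff le f + lcoeff le g = 0" "f + g \<noteq> 0"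
    using that lk bd lcoeff_nonzero[OF pol] by (auto simp: lcoeff_def in_keys_iff)
qed

lemma single_mult_nonzero:
  assumes "f \<in> polys l" "f \<noteq> 0" "c \<noteq> 0"
  shows "Poly_Mapping.single u c * f \<noteq> (0 :: ipoly)"
  using lookup_single_mult[of u c f "lexp le f"] lcoeff_nonzero[OF assms(1,2)] assms(3)
  by (auto simp: lcoeff_def)

section \<open>Strong bases of a fixed ideal\<close>

context
  fixes I :: "ipoly set"
  assumes ideal: "poly_ideal l I"
begin

lemma ideal_polys: "f \<in> I \<Longrightarrow> f \<in> polys l"
  using ideal by (auto simp: poly_ideal_def)

lemma ideal_single_mult: "f \<in> I \<Longrightarrow> u \<in> monoms l \<Longrightarrow> Poly_Mapping.single u c * f \<in> I"
  using ideal polys_single unfolding poly_ideal_def by blast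

text \<open>Together with 0, the leading coefficients of ideal elements with leading exponent
  \<open>m\<close> form an ideal of the integers. By Euclidean division a nonzero member of least
  absolute value generates it.\<close>

lemma minimal_lcoeff:
  assumes "m \<in> lexp le ` (I - {0})"
  shows "\<exists>f\<in>I - {0}. lexp le f = m \<and> (\<forall>g\<in>I - {0}. lexp le g = m \<longrightarrow> lcoeff le f dvd lcoeff le g)"
proof -
  let ?P = "\<lambda>f. f \<in> I - {0} \<and> lexp le f = m"
  obtain f0 where "?P f0" using assms by auto
  then have "\<exists>f. ?P f \<and> (\<forall>g. ?P g \<longrightarrow> nat \<bar>lcoeff le f\<bar> \<le> nat \<bar>lcoeff le g\<bar>)"
    by (rule ex_has_least_nat)
  then obtain f where f: "?P f" "\<And>g. ?P g \<Longrightarrow> nat \<bar>lcoeff le f\<bar> \<le> nat \<bar>lcoeff le g\<bar>"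
    by blast
  have "lcoeff le f dvd lcoeff le g" if g: "?P g" for g
  proof (rule ccontr)
    assume ndvd: "\<not> lcoeff le f dvd lcoeff le g"
    define c where "c = lcoeff le g div lcoeff le f"
    define h where "h = Poly_Mapping.single 0 (- c) * f"
    have fp: "f \<in> polys l" "g \<in> polys l" using f g ideal_polys by auto
    have d0: "lcoeff le f \<noteq> 0" using fp f lcoeff_nonzero by blast
    have md: "lcoeff le g - c * lcoeff le f = lcoeff le g mod lcoeff le f"
      by (simp add: c_def minus_div_mult_eq_mod)
    have md0: "lcoeff le g mod lcoeff le f \<noteq> 0" using ndvd by (simp add: dvd_eq_mod_eq_0)
    have "\<exists>g'. ?P g' \<and> lcoeff le g' = lcoeff le g mod lcoeff le f"
    \<comment> \<open>For quotient 0 the multiple \<open>h\<close> is 0 and has no leading exponent,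
      but then \<open>g\<close> itself already has the remainder as leading coefficient.\<close>
    proof (cases "c = 0")
      case True
      then show ?thesis using md g by auto
    next
      case False
      have f': "f \<in> I" "f \<noteq> 0" "- c \<noteq> 0" "lexp le f = m" using f(1) False by auto
      have h: "h \<in> I" "h \<noteq> 0" "lexp le h = m" "lcoeff le h = - c * lcoeff le f"
        unfolding h_def using ideal_single_mult[OF f'(1) monoms_zero] single_mult_nonzero[OF fp(1) f'(2,3)]
          lexp_single_mult[OF fp(1) f'(2) monoms_zero f'(3)]
          lcoeff_single_mult[OF fp(1) f'(2) monoms_zero f'(3)] f'(4) by simp_all
      have "g + h \<in> I" using g h(1) ideal by (auto simp: poly_ideal_def)
      moreover have "g + h \<noteq> 0 \<and> lexp le (g + h) = m \<and> lcoeff le (g + h) = lcoeff le g + lcoeff le h"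
        using lexp_add_same(1)[of g h] g h fp md md0 ideal_polys[OF h(1)] by simp
      ultimately show ?thesis using md h(4) by (intro exI[of _ "g + h"]) simp
    qed
    then obtain g' where g': "?P g'" "lcoeff le g' = lcoeff le g mod lcoeff le f" by blast
    have "\<bar>lcoeff le g mod lcoeff le f\<bar> < \<bar>lcoeff le f\<bar>" using d0 by (rule abs_mod_less)
    then show False using f(2)[OF g'(1)] g'(2) by simp
  qed
  then show ?thesis using f by blast
qed

text \<open>Subtracting a suitable multiple of a basis element cancels the leading term of
  \<open>f\<close>, so the leading exponent strictly drops; well-foundedness of the ordering ends
  the reduction at 0.\<close>

lemma gen_ideal_eqI:
  assumes "G \<subseteq> I - {0}" "\<And>f. f \<in> I \<Longrightarrow> f \<noteq> 0 \<Longrightarrow> \<exists>g\<in>G. lm_dvd le g f"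
  shows "gen_ideal l G = I"
proof
  show "gen_ideal l G \<subseteq> I" using assms(1) by (intro gen_ideal_least[OF ideal]) blast
  have "\<forall>f. f \<in> I \<longrightarrow> f \<noteq> 0 \<longrightarrow> lexp le f = m \<longrightarrow> f \<in> gen_ideal l G" for m
  proof (induction m rule: wf_induct_rule[OF wf_term_order])
    case (1 m)
    show ?case
    proof (intro allI impI)
      fix f assume f: "f \<in> I" "f \<noteq> 0" "lexp le f = m"
      obtain g where g: "g \<in> G" "lm_dvd le g f" using assms f by blast
      then have gI: "g \<in> I" "g \<noteq> 0" using assms by auto
      have fp: "f \<in> polys l" "g \<in> polys l" using f gI ideal_polys by auto
      define u where "u = lexp le f - lexp le g"
      have u: "u \<in> monoms l" using f(2) fp lexp_monoms monoms_minus unfolding u_def by blast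
      have ug: "u + lexp le g = lexp le f"
        using g(2) unfolding u_def lm_dvd_def by (intro monom_minus_add) auto
      obtain c where c: "lcoeff le f = lcoeff le g * c" using g by (auto simp: lm_dvd_def)
      have c0: "c \<noteq> 0" using c lcoeff_nonzero f fp by auto
      define h where "h = Poly_Mapping.single u (- c) * g"
      have c1: "- c \<noteq> 0" using c0 by simp
      have h: "h \<in> I" "h \<noteq> 0" "lexp le h = lexp le f" "lcoeff le f + lcoeff le h = 0"
        unfolding h_def using ideal_single_mult[OF gI(1) u] single_mult_nonzero[OF fp(2) gI(2) c1]
          lexp_single_mult[OF fp(2) gI(2) u c1] lcoeff_single_mult[OF fp(2) gI(2) u c1] c ug
        by simp_all
      have fhI: "f + h \<in> I" using f h ideal by (auto simp: poly_ideal_def)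
      have "f + h \<in> gen_ideal l G"
      proof (cases "f + h = 0")
        case True
        then show ?thesis using gen_ideal_zero by simp
      next
        case False
        then have "le (lexp le (f + h)) m \<and> lexp le (f + h) \<noteq> m"
          using lexp_add_same(2)[of f h] f fp h ideal_polys[OF h(1)] by simp
        moreover have "lexp le (f + h) \<in> monoms l" "m \<in> monoms l"
          using False fhI f fp lexp_monoms ideal_polys by auto
        ultimately show ?thesis using "1.IH" fhI False by blast
      qed
      moreover have "Poly_Mapping.single u c * g \<in> gen_ideal l G"
        using g(1) u by (intro gen_ideal_mult gen_ideal_base polys_single)
      moreover have "f = (f + h) + Poly_Mapping.single u c * g"
        by (simp add: h_def single_uminus)
      ultimately show "f \<in> gen_ideal l G" using gen_ideal_add by metis
    qed
  qed
  then show "I \<subseteq> gen_ideal l G" using gen_ideal_zero by blast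
qed

text \<open>For each leading exponent \<open>m\<close> of the ideal, \<open>b m\<close> carries the
  generator of its leading coefficients. Keeping the \<open>b m\<close> whose leading term is
  divisible by no other one leaves a minimal strong basis.\<close>

theorem min_strong_gb_exists: "\<exists>G. min_strong_gb l le I G"
proof -
  define M where "M = lexp le ` (I - {0})"
  obtain b where b: "\<And>m. m \<in> M \<Longrightarrow> b m \<in> I - {0}" "\<And>m. m \<in> M \<Longrightarrow> lexp le (b m) = m"
    "\<And>m g. m \<in> M \<Longrightarrow> g \<in> I - {0} \<Longrightarrow> lexp le g = m \<Longrightarrow> lcoeff le (b m) dvd lcoeff le g"
  proof -
    have "\<forall>m\<in>M. \<exists>f. f \<in> I - {0} \<and> lexp le f = m \<and>
        (\<forall>g\<in>I - {0}. lexp le g = m \<longrightarrow> lcoeff le f dvd lcoeff le g)"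
      using minimal_lcoeff unfolding M_def by blast
    from bchoice[OF this] show ?thesis using that by blast
  qed
  define M0 where "M0 = {m \<in> M. \<forall>m'\<in>M. m' \<noteq> m \<longrightarrow> \<not> lm_dvd le (b m') (b m)}"
  have M: "M \<subseteq> monoms l" unfolding M_def using lexp_monoms ideal_polys by auto
  \<comment> \<open>Multiplying \<open>b m\<close> by the monomial \<open>u\<close> raises its
    exponent to \<open>m'\<close> with the same leading coefficient, so the generator at
    \<open>m'\<close> divides it.\<close>
  have dvd: "lcoeff le (b m') dvd lcoeff le (b m)"
    if "m \<in> M" "m' \<in> M" "\<And>k. Poly_Mapping.lookup m k \<le> Poly_Mapping.lookup m' k" for m m'
  proof -
    define u where "u = m' - m"
    have u: "u \<in> monoms l" "u + m = m'"
      unfolding u_def using that(2) M monoms_minus monom_minus_add[OF that(3)] by blast+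
    define f where "f = Poly_Mapping.single u 1 * b m"
    have bm: "b m \<in> I" "b m \<noteq> 0" using b(1)[OF that(1)] by auto
    have bp: "b m \<in> polys l" using bm(1) by (rule ideal_polys)
    have "f \<in> I - {0}" "lexp le f = m'" "lcoeff le f = lcoeff le (b m)"
      unfolding f_def using ideal_single_mult[OF bm(1) u(1)] single_mult_nonzero[OF bp bm(2), of 1 u]
        lexp_single_mult[OF bp bm(2) u(1), of 1] lcoeff_single_mult[OF bp bm(2) u(1), of 1]
        u(2) b(2)[OF that(1)] by simp_all
    then show ?thesis using b(3)[OF that(2), of f] by simp
  qed
  have "finite M0"
  proof (rule ccontr)
    assume "infinite M0"
    then obtain m :: "nat \<Rightarrow> monom" where m: "inj m" "range m \<subseteq> M0"
      using infinite_countable_subset by blast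
    then have mM: "m i \<in> M" and mM0: "m i \<in> M0" for i by (auto simp: M0_def)
    obtain r :: "nat \<Rightarrow> nat" where r: "strict_mono r"
      "\<And>i j k. i \<le> j \<Longrightarrow> Poly_Mapping.lookup (m (r i)) k \<le> Poly_Mapping.lookup (m (r j)) k"
      using dickson[of m l] subsetD[OF M mM] by blast
    define d where "d i = lcoeff le (b (m (r i)))" for i
    have d0: "d i \<noteq> 0" for i
      unfolding d_def using b(1)[OF mM, of "r i"] by (intro lcoeff_nonzero ideal_polys) auto
    \<comment> \<open>Along the Dickson chain each coefficient divides the one before. At an index
      of least absolute value the next coefficient is therefore associate to it, and one kept
      leading term divides another.\<close>
    obtain i where i: "\<And>j. nat \<bar>d i\<bar> \<le> nat \<bar>d j\<bar>"
      using ex_has_least_nat[of "\<lambda>_. True" 0 "\<lambda>j. nat \<bar>d j\<bar>"] by auto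
    have "d (Suc i) dvd d i" unfolding d_def by (intro dvd mM r(2)) simp
    moreover have "\<bar>d i\<bar> \<le> \<bar>d (Suc i)\<bar>" using i[of "Suc i"] by simp
    ultimately have "\<bar>d i\<bar> = \<bar>d (Suc i)\<bar>"
      using dvd_imp_le_int[OF d0] by (simp add: order_antisym)
    then have "d i dvd d (Suc i)" by (metis abs_dvd_iff dvd_abs_iff dvd_refl)
    then have "lm_dvd le (b (m (r i))) (b (m (r (Suc i))))"
      using b(2)[OF mM] r(2)[of i "Suc i"] by (simp add: lm_dvd_def d_def)
    moreover have "m (r i) \<noteq> m (r (Suc i))" using m(1) r(1) by (simp add: inj_eq strict_mono_eq)
    ultimately show False using mM0[of "r (Suc i)"] mM[of "r i"] unfolding M0_def by blast
  qed
  have red: "\<exists>m0\<in>M0. lm_dvd le (b m0) (b m)" if "m \<in> M" for m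
    using that
  \<comment> \<open>A discarded exponent is properly divisible by another leading exponent, which
    has smaller total degree.\<close>
  proof (induction "\<Sum>k<l. Poly_Mapping.lookup m k" arbitrary: m rule: less_induct)
    case less
    show ?case
    proof (cases "m \<in> M0")
      case True
      then show ?thesis by (auto simp: lm_dvd_def)
    next
      case False
      then obtain m' where m': "m' \<in> M" "m' \<noteq> m" "lm_dvd le (b m') (b m)"
        using less.prems unfolding M0_def by blast
      then have le: "Poly_Mapping.lookup m' k \<le> Poly_Mapping.lookup m k" for k
        using b(2)[OF less.prems] b(2)[OF m'(1)] by (simp add: lm_dvd_def)
      obtain k where k: "Poly_Mapping.lookup m' k \<noteq> Poly_Mapping.lookup m k"
        using m'(2) poly_mapping_eqI[of m' m] by metis
      then have "Poly_Mapping.lookup m k \<noteq> 0" using le[of k] by simp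
      then have "k < l" using subsetD[OF M less.prems] by (auto simp: monoms_def in_keys_iff subset_iff)
      then have "(\<Sum>k<l. Poly_Mapping.lookup m' k) < (\<Sum>k<l. Poly_Mapping.lookup m k)"
        using le le_neq_implies_less[OF le k] by (intro sum_strict_mono_ex1) auto
      then obtain m0 where "m0 \<in> M0" "lm_dvd le (b m0) (b m')" using less.hyps m'(1) by blast
      then show ?thesis using m'(3) lm_dvd_trans by blast
    qed
  qed
  have "\<exists>g\<in>b ` M0. lm_dvd le g f" if "f \<in> I" "f \<noteq> 0" for f
  proof -
    have f: "lexp le f \<in> M" using that unfolding M_def by blast
    then have "lm_dvd le (b (lexp le f)) f" using b(2)[OF f] b(3)[OF f, of f] that by (simp add: lm_dvd_def)
    then show ?thesis using red[OF f] lm_dvd_trans by blast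
  qed
  moreover have "b ` M0 \<subseteq> I - {0}" 
    by (intro image_subsetI b(1)) (simp add: M0_def)
  moreover have "\<not> lm_dvd le g g'" if "g \<in> b ` M0" "g' \<in> b ` M0" "g \<noteq> g'" for g g'
  proof -
    obtain m m' where "m \<in> M0" "m' \<in> M0" "g = b m" "g' = b m'"
      using \<open>g \<in> b ` M0\<close> \<open>g' \<in> b ` M0\<close> by blast
    moreover from this have "m \<noteq> m'" using \<open>g \<noteq> g'\<close> by auto
    ultimately show ?thesis by (simp add: M0_def)
  qed
  ultimately have "min_strong_gb l le I (b ` M0)"
    unfolding min_strong_gb_def using \<open>finite M0\<close> gen_ideal_eqI[of "b ` M0"] by blast
  then show ?thesis by blast
qed

end
end

section \<open>Ideals of linear forms\<close>

definition var :: "nat \<Rightarrow> monom" where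
  "var k = Poly_Mapping.single k 1"

lemma lookup_var: "Poly_Mapping.lookup (var k) j = (if j = k then 1 else 0)"
  by (simp add: var_def lookup_single when_def)

lemma var_eq_iff: "var j = var k \<longleftrightarrow> j = k"
  by (metis lookup_var zero_neq_one)

lemma var_monoms: "k < l \<Longrightarrow> var k \<in> monoms l"
  unfolding var_def by (rule monoms_single)

lemma linpoly_var: "linpoly l a i = (\<Sum>k<l. Poly_Mapping.single (var k) (a i k))"
  by (simp add: linpoly_def var_def)

lemma linpoly_polys: "linpoly l a i \<in> polys l"
  unfolding linpoly_var by (intro polys_sum polys_single var_monoms) simp

text \<open>Every monomial of a multiple of the variable \<open>j\<close> contains that variable;
  among the exponents queried here only \<open>var j\<close> does.\<close>

lemma lookup_single_var_mult:
  fixes c :: ipoly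
  shows "Poly_Mapping.lookup (Poly_Mapping.single (var j) d * c) (var k)
      = (if j = k then d * Poly_Mapping.lookup c 0 else 0)"
    and "Poly_Mapping.lookup (Poly_Mapping.single (var j) d * c) 0 = 0"
proof -
  have nokey: "Poly_Mapping.lookup (Poly_Mapping.single (var j) d * c) m = 0"
    if "Poly_Mapping.lookup m j = 0" for m
  proof (rule ccontr)
    assume "\<not> ?thesis"
    then have "m \<in> Poly_Mapping.keys (Poly_Mapping.single (var j) d * c)"
      by (simp add: in_keys_iff)
    then obtain m' where "m = var j + m'"
      using keys_mult[of "Poly_Mapping.single (var j) d" c] by (auto split: if_splits)
    then show False using that by (simp add: lookup_add lookup_var)
  qed
  show "Poly_Mapping.lookup (Poly_Mapping.single (var j) d * c) 0 = 0"
    by (rule nokey) simp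
  show "Poly_Mapping.lookup (Poly_Mapping.single (var j) d * c) (var k)
      = (if j = k then d * Poly_Mapping.lookup c 0 else 0)"
    using lookup_single_mult[of "var j" d c 0] nokey[of "var k"] by (auto simp: lookup_var)
qed

lemma
  fixes c :: ipoly
  shows lookup_mult_linpoly_var: "k < l \<Longrightarrow>
      Poly_Mapping.lookup (c * linpoly l a i) (var k) = Poly_Mapping.lookup c 0 * a i k"
    and lookup_mult_linpoly_zero: "Poly_Mapping.lookup (c * linpoly l a i) 0 = 0"
  unfolding linpoly_var sum_distrib_left lookup_sum
  by (simp_all add: mult.commute[of c] lookup_single_var_mult sum.delta)

text \<open>All generators lack a constant term. This later excludes basis elements with constant
  leading monomial.\<close>

lemma gen_ideal_linpoly_zero:
  assumes "f \<in> gen_ideal l (linpoly l a ` S)"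
  shows "Poly_Mapping.lookup f 0 = 0"
  using assms unfolding gen_ideal_def
  by (auto simp: lookup_sum subset_iff lookup_mult_linpoly_zero intro!: sum.neutral)
    (metis imageE lookup_mult_linpoly_zero)

text \<open>Since the generators have no constant term, only the constant terms of the cofactors
  reach degree one. The linear part of \<open>f\<close> is thus an integer combination of the
  generating forms and vanishes at their common zeros, whatever the higher terms of \<open>f\<close>
  are.\<close>

lemma gen_ideal_linpoly_linear_part:
  fixes P :: "nat \<Rightarrow> 'k::comm_ring_1"
  assumes "f \<in> gen_ideal l (linpoly l a ` S)" "\<And>i. i \<in> S \<Longrightarrow> lform l a i P = 0"
  shows "(\<Sum>k<l. of_int (Poly_Mapping.lookup f (var k)) * P k) = 0"
proof -
  obtain T c where T: "finite T" "T \<subseteq> linpoly l a ` S" "f = (\<Sum>g\<in>T. c g * g)"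
    using assms(1) by (auto simp: gen_ideal_def)
  have *: "(\<Sum>k<l. of_int (Poly_Mapping.lookup (c g * g) (var k)) * P k) = 0" if g: "g \<in> T" for g
  proof -
    obtain i where i: "i \<in> S" "g = linpoly l a i" using T(2) g by blast
    have "(\<Sum>k<l. of_int (Poly_Mapping.lookup (c g * g) (var k)) * P k)
        = of_int (Poly_Mapping.lookup (c g) 0) * lform l a i P"
      unfolding lform_def sum_distrib_left i(2)
      by (intro sum.cong) (simp_all add: lookup_mult_linpoly_var mult.assoc)
    then show ?thesis using assms(2)[OF i(1)] by simp
  qed
  have "(\<Sum>k<l. of_int (Poly_Mapping.lookup f (var k)) * P k)
      = (\<Sum>g\<in>T. \<Sum>k<l. of_int (Poly_Mapping.lookup (c g * g) (var k)) * P k)"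
    unfolding T(3) by (subst sum.swap) (simp add: lookup_sum sum_distrib_right)
  then show ?thesis using * by simp
qed

lemma combination_in_gen_ideal:
  "(\<Sum>j\<in>S. Poly_Mapping.single 0 (c j) * linpoly l a j) \<in> gen_ideal l (linpoly l a ` S)"
proof -
  have "poly_ideal l (gen_ideal l (linpoly l a ` S))"
    using linpoly_polys by (intro poly_ideal_gen_ideal) blast
  then show ?thesis
    by (rule poly_ideal_sum) (intro gen_ideal_mult gen_ideal_base polys_single monoms_zero imageI)
qed

text \<open>By assumption D, an integer multiple of each variable lies in the ideal, so every variable
  is the leading monomial of a Groebner basis element. The linear parts of these elements vanish at
  P and form a system that is triangular for the term ordering, with diagonal entries the leading
  coefficients, which are units in characteristic p by luckiness.\<close>
lemma lucky_common_zero: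
  fixes P :: "nat \<Rightarrow> 'k::field"
  assumes order: "term_order l le"
    and lucky: "lucky l le (gen_ideal l (linpoly l a ` S)) p"
    and D: "\<And>k. k < l \<Longrightarrow> \<exists>D c. D \<noteq> (0::int) \<and>
      (\<forall>m<l. (\<Sum>j\<in>S. c j * a j m) = (if m = k then D else 0))"
    and char: "\<And>z. of_int z = (0::'k) \<longleftrightarrow> int p dvd z"
    and P: "P \<in> vecs l" "\<And>i. i \<in> S \<Longrightarrow> lform l a i P = 0"
  shows "P = (\<lambda>_. 0)"
proof (rule ccontr)
  assume nz: "P \<noteq> (\<lambda>_. 0)"
  let ?I = "gen_ideal l (linpoly l a ` S)"
  have ideal: "poly_ideal l ?I" using linpoly_polys by (intro poly_ideal_gen_ideal) blast
  obtain G where G: "min_strong_gb l le ?I G" using min_strong_gb_exists[OF order ideal] by blast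
  then have GI: "g \<in> ?I \<and> g \<noteq> 0" if "g \<in> G" for g
    using that unfolding min_strong_gb_def by blast
  have Gdvd: "\<exists>g\<in>G. lm_dvd le g f" if "f \<in> ?I" "f \<noteq> 0" for f
    using G that unfolding min_strong_gb_def by blast
  \<comment> \<open>The triangular system is solved by a least counterexample: among the variables
    with nonzero coordinate of \<open>P\<close>, take the smallest one in the term ordering.\<close>
  let ?A = "{var k |k. k < l \<and> P k \<noteq> 0}"
  obtain k0 where k0: "P k0 \<noteq> 0" using nz by blast
  then have "k0 < l" using P(1)
    unfolding vecs_def by (metis (mono_tags, lifting) linorder_not_le mem_Collect_eq)
  then have "var k0 \<in> ?A" using k0 by blast
  from wfE_min[OF wf_term_order[OF order] this] obtain v where v: "v \<in> ?A"
    "\<And>u. (u, v) \<in> {(m, m'). m \<in> monoms l \<and> m' \<in> monoms l \<and> le m m' \<and> m \<noteq> m'} \<Longrightarrow> u \<notin> ?A"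
    by blast
  obtain k where k: "v = var k" "k < l" "P k \<noteq> 0" using v(1) by blast
  have min: "P m = 0" if "m < l" "m \<noteq> k" "le (var m) (var k)" for m
    using v(2)[of "var m"] that var_monoms[OF that(1)] var_monoms[OF k(2)]
    unfolding k(1) by (auto simp: var_eq_iff)
  obtain d c where c: "d \<noteq> (0::int)" "\<forall>m<l. (\<Sum>j\<in>S. c j * a j m) = (if m = k then d else 0)"
    using D[OF k(2)] by blast
  have "(\<Sum>j\<in>S. Poly_Mapping.single 0 (c j) * linpoly l a j) =
      (\<Sum>m<l. \<Sum>j\<in>S. Poly_Mapping.single (var m) (c j * a j m))"
    unfolding linpoly_var sum_distrib_left by (subst sum.swap) (simp add: mult_single)
  also have "\<dots> = (\<Sum>m<l. Poly_Mapping.single (var m) (\<Sum>j\<in>S. c j * a j m))"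
    by (intro sum.cong refl poly_mapping_eqI) (simp add: lookup_sum lookup_single when_def)
  also have "\<dots> = (\<Sum>m<l. if m = k then Poly_Mapping.single (var k) d else 0)"
    using c(2) by (intro sum.cong) auto
  finally have dk: "Poly_Mapping.single (var k) d \<in> ?I"
    using combination_in_gen_ideal[where S = S and l = l and a = a and c = c] k(2) by simp
  have lexp_dk: "lexp le (Poly_Mapping.single (var k) d) = var k"
    using c(1) le_refl[OF order] var_monoms[OF k(2)]
    by (intro lexp_eqI[OF order] polys_single) auto
  have "Poly_Mapping.single (var k) d \<noteq> 0" using c(1) by (metis lookup_single_eq lookup_zero)
  then obtain g where g: "g \<in> G" "lm_dvd le g (Poly_Mapping.single (var k) d)"
    using Gdvd[OF dk] by blast
  have gI: "g \<in> ?I" "g \<noteq> 0" using GI[OF g(1)] by auto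
  have gp: "g \<in> polys l" using gI(1) ideal by (auto simp: poly_ideal_def)
  have lc: "lcoeff le g \<noteq> 0" using lcoeff_nonzero[OF order gp gI(2)] .
  \<comment> \<open>A divisor of a variable is 1 or that variable, and 1 is impossible without a
    constant term.\<close>
  have lexp_g: "lexp le g = var k"
  proof -
    have bd: "Poly_Mapping.lookup (lexp le g) j \<le> (if j = k then 1 else 0)" for j
      using g(2) unfolding lm_dvd_def lexp_dk lookup_var by blast
    have "lexp le g \<noteq> 0" using lc gen_ideal_linpoly_zero[OF gI(1)] by (auto simp: lcoeff_def)
    then obtain j where "Poly_Mapping.lookup (lexp le g) j \<noteq> 0"
      using poly_mapping_eqI[of "lexp le g" 0] by auto
    then have "Poly_Mapping.lookup (lexp le g) k \<noteq> 0" using bd[of j] by (cases "j = k") auto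
    then have "Poly_Mapping.lookup (lexp le g) i = Poly_Mapping.lookup (var k) i" for i
      using bd[of i] by (cases "i = k") (auto simp: lookup_var)
    then show ?thesis by (rule poly_mapping_eqI)
  qed
  \<comment> \<open>Variables occurring in \<open>g\<close> other than the leading one are smaller,
    so by the choice of \<open>k\<close> their coordinates of \<open>P\<close> are 0.\<close>
  have "of_int (Poly_Mapping.lookup g (var m)) * P m
      = (if m = k then of_int (lcoeff le g) * P k else 0)" if "m < l" for m
  proof (cases "m = k \<or> Poly_Mapping.lookup g (var m) = 0")
    case True
    then show ?thesis using lexp_g lc by (auto simp: lcoeff_def)
  next
    case False
    then have "le (var m) (var k)"
      using lexp_max[OF order gp gI(2), of "var m"] lexp_g by (simp add: in_keys_iff)
    then show ?thesis using min that False by simp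
  qed
  then have "(\<Sum>m<l. of_int (Poly_Mapping.lookup g (var m)) * P m) = of_int (lcoeff le g) * P k"
    using k(2) by simp
  then have "of_int (lcoeff le g) * P k = 0"
    using gen_ideal_linpoly_linear_part[OF gI(1) P(2)] by simp
  then have "int p dvd lcoeff le g" using k(3) char by simp
  then show False using lucky G g(1) unfolding lucky_def by blast
qed

section \<open>Ranks over the rationals\<close>

text \<open>Polymorphic in the scalars, so that the solution sets of the same integer forms over the
  rationals and over the finite field can be compared.\<close>

definition common_zeros :: "nat \<Rightarrow> (nat \<Rightarrow> nat \<Rightarrow> int) \<Rightarrow> nat set \<Rightarrow> (nat \<Rightarrow> 'k::ring_1) set" where
  "common_zeros l a B = {x \<in> vecs l. \<forall>i\<in>B. lform l a i x = 0}"

lemma common_zeros_eq: "vecs l \<inter> (\<Inter>i\<in>B. hyperplane l a i) = common_zeros l a B"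
  by (auto simp: common_zeros_def hyperplane_def)

lemma lform_add: "lform l a i (\<lambda>k. x k + y k) = lform l a i x + lform l a i y"
  by (simp add: lform_def distrib_left sum.distrib)

lemma lform_diff: "lform l a i (\<lambda>k. x k - y k) = lform l a i x - lform l a i y"
  by (simp add: lform_def right_diff_distrib sum_subtractf)

lemma lform_scale: "lform l a i (\<lambda>k. c * x k) = c * lform l a i x" for c :: "'k::comm_ring_1"
  by (simp add: lform_def sum_distrib_left mult.left_commute)

lemma lform_sum: "lform l a i (\<lambda>k. \<Sum>j\<in>S. x j k) = (\<Sum>j\<in>S. lform l a i (x j))"
  unfolding lform_def by (subst sum.swap) (simp add: sum_distrib_left)

lemma lform_zero: "lform l a i (\<lambda>_. 0) = 0"
  by (simp add: lform_def)

lemma lform_unit: "m < l \<Longrightarrow> lform l a i (\<lambda>k. if k = m then 1 else 0) = of_int (a i m)"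
  by (simp add: lform_def if_distrib cong: if_cong)

lemma sum_apply: "(\<Sum>i\<in>A. f i) x = (\<Sum>i\<in>A. f i x)"
  by (induction A rule: infinite_finite_induct) simp_all

interpretation qv: vector_space "\<lambda>(c::rat) (v::nat \<Rightarrow> rat) k. c * v k"
  by unfold_locales (auto simp: fun_eq_iff algebra_simps)

text \<open>The ambient space of all functions is infinite-dimensional; this finite spanning set is
  what makes bases inside \<open>vecs l\<close> finite.\<close>

lemma vecs_subset_span:
  "vecs l \<subseteq> qv.span ((\<lambda>m k. if k = m then 1 else 0) ` {..<l})"
proof
  fix x :: "nat \<Rightarrow> rat" assume "x \<in> vecs l"
  then have "x = (\<Sum>m<l. (\<lambda>k. x m * (if k = m then 1 else 0)))"
    by (auto simp: fun_eq_iff vecs_def sum_apply if_distrib cong: if_cong)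
  also have "\<dots> \<in> qv.span ((\<lambda>m k. if k = m then 1 else 0) ` {..<l})"
    by (intro qv.span_sum qv.span_scale qv.span_base) blast
  finally show "x \<in> qv.span ((\<lambda>m k. if k = m then 1 else 0) ` {..<l})" .
qed

text \<open>A basis of the kernel together with \<open>v\<close> is a basis of \<open>K\<close>. The
  functional is abstract because it is used both for a coordinate and for the forms of the
  arrangement.\<close>

lemma qdim_hyperplane_section:
  fixes f :: "(nat \<Rightarrow> rat) \<Rightarrow> rat"
  assumes K: "qv.subspace K" "K \<subseteq> vecs l"
    and f: "\<And>x y. f (x + y) = f x + f y" "\<And>c x. f (\<lambda>k. c * x k) = c * f x"
    and v: "v \<in> K" "f v \<noteq> 0"
  shows "qdim K = Suc (qdim {x \<in> K. f x = 0})"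
proof -
  let ?K0 = "{x \<in> K. f x = 0}"
  have f0: "f 0 = 0" using f(2)[of 0 0] by (simp add: zero_fun_def)
  have K0: "qv.subspace ?K0"
    using K(1) f f0 by (auto simp: qv.subspace_def)
  obtain b where b: "b \<subseteq> ?K0" "qv.independent b" "?K0 \<subseteq> qv.span b" "card b = qv.dim ?K0"
    using qv.basis_exists by blast
  have "b \<subseteq> qv.span ((\<lambda>m k. if k = m then 1 else 0) ` {..<l})"
    using b(1) K(2) vecs_subset_span[of l] by auto
  then have fin: "finite b" using qv.independent_span_bound[OF _ b(2)] by blast
  have "qv.span b \<subseteq> ?K0" using b(1) K0 by (rule qv.span_minimal)
  then have nv: "v \<notin> qv.span b" using v by blast
  have "K \<subseteq> qv.span (insert v b)"
  proof
    fix x assume x: "x \<in> K"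
    \<comment> \<open>The projection of \<open>x\<close> along \<open>v\<close> into the kernel of
      \<open>f\<close>.\<close>
    define y where "y = x - (\<lambda>k. (f x / f v) * v k)"
    have y: "y + (\<lambda>k. (f x / f v) * v k) = x" by (simp add: y_def)
    have "f y = 0" using f(1)[of y "\<lambda>k. (f x / f v) * v k"] f(2)[of "f x / f v" v] v(2) y by simp
    moreover have "y \<in> K" unfolding y_def
      using K(1) x v(1) by (intro qv.subspace_diff qv.subspace_scale)
    ultimately have "y \<in> qv.span b" using b(3) by blast
    then show "x \<in> qv.span (insert v b)" unfolding qv.span_insert y_def by blast
  qed
  moreover have "insert v b \<subseteq> K" using b(1) v(1) by blast
  moreover have "qv.independent (insert v b)" using nv b(2) by (rule qv.independent_insertI)
  moreover have "card (insert v b) = Suc (qv.dim ?K0)"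
  proof -
    have "v \<notin> b" using nv qv.span_base by blast
    then show ?thesis using fin b(4) by simp
  qed
  ultimately have "qv.dim K = Suc (qv.dim ?K0)" by (intro qv.dim_unique)
  then show ?thesis by (simp add: qdim_def)
qed

lemma subspace_vecs: "qv.subspace (vecs l)"
  by (auto simp: qv.subspace_def vecs_def)

lemma qdim_zero: "qdim {\<lambda>_. 0} = 0"
  unfolding qdim_def by (rule qv.dim_unique[OF _ _ qv.independent_empty]) (auto simp: zero_fun_def)

lemma qdim_vecs: "qdim (vecs l) = l"
proof (induction l)
  case 0
  have "vecs 0 = {\<lambda>_. 0 :: rat}" by (auto simp: vecs_def)
  then show ?case by (simp add: qdim_zero)
next
  case (Suc l)
  have eq: "{x \<in> vecs (Suc l). x l = 0} = (vecs l :: (nat \<Rightarrow> rat) set)"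
    unfolding vecs_def by (auto simp del: all_simps) (metis Suc_leI le_neq_implies_less)
  have "qdim (vecs (Suc l)) = Suc (qdim {x \<in> vecs (Suc l). x l = 0})"
    by (rule qdim_hyperplane_section[OF subspace_vecs order_refl, of "\<lambda>x. x l" "\<lambda>k. if k = l then 1 else 0"])
      (auto simp: vecs_def)
  then show ?case using Suc by (simp add: eq)
qed

lemma subspace_common_zeros: "qv.subspace (common_zeros l a B)"
  by (auto simp: qv.subspace_def common_zeros_def vecs_def lform_scale plus_fun_def zero_fun_def
      lform_zero lform_add)

lemma common_zeros_empty: "common_zeros l a {} = vecs l"
  by (simp add: common_zeros_def)

lemma common_zeros_insert:
  "common_zeros l a (insert i B) = {x \<in> common_zeros l a B. lform l a i x = 0}"
  by (auto simp: common_zeros_def)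

lemma qdim_common_zeros_insert:
  fixes v :: "nat \<Rightarrow> rat"
  assumes "v \<in> common_zeros l a B" "lform l a i v \<noteq> 0"
  shows "qdim (common_zeros l a B) = Suc (qdim (common_zeros l a (insert i B)))"
  unfolding common_zeros_insert
  using assms by (intro qdim_hyperplane_section[where l = l and v = v] subspace_common_zeros)
    (auto simp: common_zeros_def lform_scale plus_fun_def lform_add)

lemma qdim_common_zeros_ge:
  assumes "finite B"
  shows "l \<le> qdim (common_zeros l a B) + card B"
  using assms
proof (induction B rule: finite_induct)
  case empty
  then show ?case by (simp add: common_zeros_empty qdim_vecs)
next
  case (insert i B)
  show ?case
  proof (cases "\<exists>v\<in>common_zeros l a B. lform l a i v \<noteq> (0::rat)")
    case True
    then show ?thesis using insert qdim_common_zeros_insert by fastforce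
  next
    case False
    then have "common_zeros l a (insert i B) = (common_zeros l a B :: (nat \<Rightarrow> rat) set)"
      by (auto simp: common_zeros_insert)
    then show ?thesis using insert by simp
  qed
qed

text \<open>The equation \<open>qdim (common_zeros l a B) + card B = l\<close> expresses
  independence of the forms in \<open>B\<close> through their zeros. The extension is greedy: a form
  is added exactly when it does not vanish on the current common zeros.\<close>

lemma independent_subset_extension:
  assumes "finite C" "finite B\<^sub>0" "qdim (common_zeros l a B\<^sub>0) + card B\<^sub>0 = l"
  shows "\<exists>B. B\<^sub>0 \<subseteq> B \<and> B \<subseteq> B\<^sub>0 \<union> C \<and> qdim (common_zeros l a B) + card B = l \<and>
    common_zeros l a B = (common_zeros l a (B\<^sub>0 \<union> C) :: (nat \<Rightarrow> rat) set)"
  using assms(1)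
proof (induction C rule: finite_induct)
  case empty
  then show ?case using assms by auto
next
  case (insert i C)
  then obtain B where B: "B\<^sub>0 \<subseteq> B" "B \<subseteq> B\<^sub>0 \<union> C" "qdim (common_zeros l a B) + card B = l"
    "common_zeros l a B = (common_zeros l a (B\<^sub>0 \<union> C) :: (nat \<Rightarrow> rat) set)" by blast
  have eq: "common_zeros l a (B\<^sub>0 \<union> insert i C) = (common_zeros l a (insert i B) :: (nat \<Rightarrow> rat) set)"
    using B(4) by (simp add: common_zeros_insert)
  show ?case
  proof (cases "\<exists>v\<in>common_zeros l a B. lform l a i v \<noteq> (0::rat)")
    case True
    then obtain v :: "nat \<Rightarrow> rat" where v: "v \<in> common_zeros l a B" "lform l a i v \<noteq> 0" by blast
    have "i \<notin> B" using v by (auto simp: common_zeros_def)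
    moreover have "finite B" using B(2) insert(1) assms(2) by (meson finite_UnI finite_subset)
    ultimately have "qdim (common_zeros l a (insert i B)) + card (insert i B) = l"
      using B(3) qdim_common_zeros_insert[OF v] by simp
    then show ?thesis using B(1,2) eq by (intro exI[of _ "insert i B"]) auto
  next
    case False
    then have "common_zeros l a (insert i B) = (common_zeros l a B :: (nat \<Rightarrow> rat) set)"
      by (auto simp: common_zeros_insert)
    then show ?thesis using B eq by (intro exI[of _ B]) auto
  qed
qed

section \<open>Dual bases and integer relations\<close>

text \<open>The \<open>l - 1\<close> forms other than \<open>j\<close> have a nonzero common zero.
  The form \<open>j\<close> cannot vanish there, since all of \<open>S\<close> has only the trivial
  zero, so the vector can be rescaled.\<close>

lemma dual_vectors:
  assumes "finite S" "card S = l" "common_zeros l a S = {\<lambda>_. 0 :: rat}"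
  shows "\<exists>w. \<forall>j\<in>S. w j \<in> vecs l \<and> (\<forall>i\<in>S. lform l a i (w j) = (if i = j then 1 else (0::rat)))"
proof -
  have "\<exists>w. w \<in> vecs l \<and> (\<forall>i\<in>S. lform l a i w = (if i = j then 1 else (0::rat)))" if j: "j \<in> S" for j
  proof -
    have "l \<noteq> 0" using assms(1,2) j card_0_eq[of S] by blast
    then have "qdim (common_zeros l a (S - {j})) \<noteq> 0"
      using qdim_common_zeros_ge[of "S - {j}" l a] assms j by simp
    then have "common_zeros l a (S - {j}) \<noteq> {\<lambda>_. 0 :: rat}" using qdim_zero by metis
    moreover have "(\<lambda>_. 0) \<in> (common_zeros l a (S - {j}) :: (nat \<Rightarrow> rat) set)"
      by (simp add: common_zeros_def vecs_def lform_zero)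
    ultimately obtain x :: "nat \<Rightarrow> rat" where x: "x \<in> common_zeros l a (S - {j})" "x \<noteq> (\<lambda>_. 0)"
      by blast
    define c where "c = lform l a j x"
    have "c \<noteq> 0"
    proof
      assume "c = 0"
      then have "x \<in> common_zeros l a S" using x(1) by (auto simp: common_zeros_def c_def)
      then show False using x(2) assms(3) by simp
    qed
    then show ?thesis using x(1) unfolding common_zeros_def
      by (intro exI[of _ "\<lambda>k. inverse c * x k"]) (auto simp: lform_scale vecs_def c_def)
  qed
  then show ?thesis by (intro bchoice) blast
qed

lemma dual_expansion:
  assumes "common_zeros l a S = {\<lambda>_. 0 :: rat}" "finite S"
    and w: "\<forall>j\<in>S. w j \<in> vecs l \<and> (\<forall>i\<in>S. lform l a i (w j) = (if i = j then 1 else (0::rat)))"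
    and x: "x \<in> vecs l"
  shows "x = (\<lambda>k. \<Sum>j\<in>S. lform l a j x * w j k)"
proof -
  define y where "y = (\<lambda>k. x k - (\<Sum>j\<in>S. lform l a j x * w j k))"
  have "y \<in> vecs l" using x w by (auto simp: y_def vecs_def)
  moreover have "lform l a i y = 0" if "i \<in> S" for i
  proof -
    have "(\<Sum>j\<in>S. lform l a j x * lform l a i (w j)) = (\<Sum>j\<in>S. if i = j then lform l a j x else 0)"
      using w that by (intro sum.cong) auto
    then show ?thesis using that assms(2) by (simp add: y_def lform_diff lform_sum lform_scale)
  qed
  ultimately have "y = (\<lambda>_. 0)" using assms(1) by (auto simp: common_zeros_def)
  then show ?thesis by (simp add: y_def fun_eq_iff)
qed

lemma common_denominator:
  fixes r :: "'a \<Rightarrow> rat"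
  assumes "finite S"
  shows "\<exists>D c. D > (0::int) \<and> (\<forall>j\<in>S. of_int (c j) = of_int D * r j)"
  using assms
proof (induction S rule: finite_induct)
  case empty
  then show ?case by (auto intro: exI[of _ 1])
next
  case (insert i S)
  then obtain D c where D: "D > (0::int)" "\<forall>j\<in>S. of_int (c j) = of_int D * r j" by blast
  obtain n d where q: "quotient_of (r i) = (n, d)" by fastforce
  then have d: "d > 0" "r i = of_int n / of_int d"
    using quotient_of_denom_pos quotient_of_div by blast+
  have "\<forall>j\<in>insert i S. of_int (if j = i then D * n else d * c j) = of_int (D * d) * r j"
    using D d insert(2) by auto
  moreover have "D * d > 0" using D(1) d(1) by simp
  ultimately show ?case
    by (intro exI[of _ "D * d"] exI[of _ "\<lambda>j. if j = i then D * n else d * c j"] conjI)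
qed

text \<open>The numbers \<open>w j k\<close> are the entries of the inverse of the matrix of
  \<open>S\<close>: the expansion of the unit vector at \<open>m\<close>, read at coordinate
  \<open>k\<close>, gives the relation, and \<open>D\<close> clears denominators. This is the
  assumption \<open>D\<close> of \<open>lucky_common_zero\<close>.\<close>

lemma integer_relation_unit:
  assumes S: "finite S" "card S = l" "common_zeros l a S = {\<lambda>_. 0 :: rat}" and "k < l"
  shows "\<exists>D c. D \<noteq> (0::int) \<and> (\<forall>m<l. (\<Sum>j\<in>S. c j * a j m) = (if m = k then D else 0))"
proof -
  obtain w where w: "\<forall>j\<in>S. w j \<in> vecs l \<and> (\<forall>i\<in>S. lform l a i (w j) = (if i = j then 1 else (0::rat)))"
    using dual_vectors[OF S] by blast
  obtain D c where D: "D > (0::int)" "\<forall>j\<in>S. of_int (c j) = of_int D * w j k"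
    using common_denominator[OF S(1), of "\<lambda>j. w j k"] by blast
  have "(\<Sum>j\<in>S. c j * a j m) = (if m = k then D else 0)" if m: "m < l" for m
  proof -
    let ?e = "\<lambda>k. if k = m then 1 else (0::rat)"
    have "?e \<in> vecs l" using m by (auto simp: vecs_def)
    from fun_cong[OF dual_expansion[OF S(3,1) w this], of k]
    have "?e k = (\<Sum>j\<in>S. lform l a j ?e * w j k)" .
    then have e: "?e k = (\<Sum>j\<in>S. of_int (a j m) * w j k)" by (simp add: lform_unit[OF m])
    have "(of_int (\<Sum>j\<in>S. c j * a j m) :: rat) = (\<Sum>j\<in>S. of_int D * w j k * of_int (a j m))"
      using D(2) by simp
    also have "\<dots> = of_int D * ?e k" unfolding e by (simp add: sum_distrib_left mult_ac)
    also have "\<dots> = of_int (if m = k then D else 0)" by simp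
    finally show ?thesis by (simp only: of_int_eq_iff)
  qed
  then show ?thesis using D(1) by (intro exI[of _ D] exI[of _ c]) auto
qed

text \<open>In the expansion of the form \<open>i\<close> by the forms of \<open>S\<close>, the
  coefficient at \<open>j\<close> is its value at \<open>w j\<close>. For \<open>j\<close> outside
  \<open>B\<close>, \<open>w j\<close> is a common zero of \<open>B\<close>, so that coefficient is
  0.\<close>

lemma integer_relation:
  assumes S: "finite S" "card S = l" "common_zeros l a S = {\<lambda>_. 0 :: rat}"
    and B: "B \<subseteq> S" "\<And>x :: nat \<Rightarrow> rat. x \<in> common_zeros l a B \<Longrightarrow> lform l a i x = 0"
  shows "\<exists>D c. D > (0::int) \<and> (\<forall>m<l. D * a i m = (\<Sum>j\<in>B. c j * a j m))"
proof -
  obtain w where w: "\<forall>j\<in>S. w j \<in> vecs l \<and> (\<forall>i\<in>S. lform l a i (w j) = (if i = j then 1 else (0::rat)))"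
    using dual_vectors[OF S] by blast
  have w0: "lform l a i (w j) = 0" if "j \<in> S - B" for j
    using w that B(1) by (intro B(2)) (auto simp: common_zeros_def)
  obtain D c where D: "D > (0::int)" "\<forall>j\<in>S. of_int (c j) = of_int D * lform l a i (w j)"
    using common_denominator[OF S(1), of "\<lambda>j. lform l a i (w j)"] by blast
  have "D * a i m = (\<Sum>j\<in>B. c j * a j m)" if m: "m < l" for m
  proof -
    let ?e = "\<lambda>k. if k = m then 1 else (0::rat)"
    have "?e \<in> vecs l" using m by (auto simp: vecs_def)
    from dual_expansion[OF S(3,1) w this]
    have "lform l a i ?e = lform l a i (\<lambda>k. \<Sum>j\<in>S. lform l a j ?e * w j k)" by (rule arg_cong)
    then have "of_int (a i m) = (\<Sum>j\<in>S. of_int (a j m) * lform l a i (w j))"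
      by (simp add: lform_sum lform_scale lform_unit[OF m])
    also have "\<dots> = (\<Sum>j\<in>B. of_int (a j m) * lform l a i (w j))"
      using S(1) B(1) w0 by (intro sum.mono_neutral_right) auto
    finally have "of_int D * of_int (a i m) = (\<Sum>j\<in>B. of_int (a j m) * (of_int D * lform l a i (w j)))"
      by (simp add: sum_distrib_left mult_ac)
    also have "\<dots> = of_int (\<Sum>j\<in>B. c j * a j m)"
      using D(2) B(1) by (simp add: subset_iff mult.commute)
    finally have "(of_int (D * a i m) :: rat) = of_int (\<Sum>j\<in>B. c j * a j m)" by simp
    then show ?thesis by (simp only: of_int_eq_iff)
  qed
  then show ?thesis using D(1) by blast
qed

section \<open>Reduction to the finite field\<close>

lemma of_int_eq_zero_iff_dvd:
  assumes "prime p" "card (UNIV :: 'k::{finite,field} set) = p ^ e"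
  shows "of_int z = (0::'k) \<longleftrightarrow> int p dvd z"
proof -
  \<comment> \<open>Translation by 1 permutes the field, so comparing sums over all elements shows
    that the field size is 0 in the field, and hence so is \<open>p\<close>.\<close>
  have "(\<Sum>x\<in>UNIV. x + (1::'k)) = (\<Sum>x\<in>UNIV. x)"
    by (rule sum.reindex_bij_witness[of _ "\<lambda>x. x - 1" "\<lambda>x. x + 1"]) auto
  then have "of_nat (card (UNIV :: 'k set)) = (0::'k)" by (simp add: sum.distrib)
  then have p0: "of_nat p = (0::'k)" using assms(2) by simp
  show ?thesis
  proof
    assume "int p dvd z"
    then obtain c where "z = int p * c" by blast
    then show "of_int z = (0::'k)" using p0 by simp
  next
    assume z: "of_int z = (0::'k)"
    show "int p dvd z"
    proof (rule ccontr)
      assume "\<not> int p dvd z"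
      then have "coprime (int p) z" using assms(1) by (intro prime_imp_coprime) simp_all
      then obtain u v where "u * int p + v * z = 1" using bezout_int[of "int p" z] by auto
      then have "of_int (u * int p + v * z) = (1::'k)" by simp
      then show False using p0 z by simp
    qed
  qed
qed

lemma
  fixes l :: nat
  shows finite_vecs: "finite (vecs l :: (nat \<Rightarrow> 'k::{finite,zero}) set)"
    and card_vecs: "card (vecs l :: (nat \<Rightarrow> 'k) set) = card (UNIV :: 'k set) ^ l"
proof -
  have "bij_betw (\<lambda>x. restrict x {..<l}) (vecs l :: (nat \<Rightarrow> 'k) set) ({..<l} \<rightarrow>\<^sub>E UNIV)"
    \<comment> \<open>Vectors are padded with 0 from index \<open>l\<close> on, extensional
      functions with \<open>undefined\<close>; the two maps exchange the paddings.\<close>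
    by (rule bij_betw_byWitness[where f' = "\<lambda>f k. if k < l then f k else 0"])
      (auto simp: vecs_def fun_eq_iff PiE_def extensional_def)
  from bij_betw_finite[OF this] bij_betw_same_card[OF this]
  show "finite (vecs l :: (nat \<Rightarrow> 'k) set)"
    "card (vecs l :: (nat \<Rightarrow> 'k) set) = card (UNIV :: 'k set) ^ l"
    by (simp_all add: finite_PiE card_PiE)
qed

text \<open>Evaluating all forms of \<open>S\<close> is injective because their only common zero is
  trivial, and source and target both have size \<open>card (UNIV :: 'k set) ^ l\<close>, so it is a
  bijection. Under it the zeros of \<open>B\<close> become the value tuples vanishing on
  \<open>B\<close>, with \<open>l - card B\<close> free entries.\<close>

lemma
  fixes l :: nat and a :: "nat \<Rightarrow> nat \<Rightarrow> int"
  assumes S: "finite S" "card S = l" "common_zeros l a S = {\<lambda>_. 0 :: 'k::{finite,field}}"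
  shows lforms_surj: "\<exists>P\<in>vecs l. \<forall>j\<in>S. lform l a j P = (f j :: 'k)"
    and card_common_zeros_subset: "B \<subseteq> S \<Longrightarrow>
      card (common_zeros l a B :: (nat \<Rightarrow> 'k) set) = card (UNIV :: 'k set) ^ (l - card B)"
proof -
  define \<Phi> where "\<Phi> P = restrict (\<lambda>j. lform l a j P :: 'k) S" for P
  have inj: "inj_on \<Phi> (vecs l)"
  proof (rule inj_onI)
    fix P Q :: "nat \<Rightarrow> 'k" assume PQ: "P \<in> vecs l" "Q \<in> vecs l" "\<Phi> P = \<Phi> Q"
    have "lform l a j P = lform l a j Q" if "j \<in> S" for j
      using fun_cong[OF PQ(3), of j] that by (simp add: \<Phi>_def)
    then have "(\<lambda>k. P k - Q k) \<in> common_zeros l a S"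
      using PQ(1,2) by (simp add: common_zeros_def lform_diff vecs_def)
    then show "P = Q" using S(3) by (simp add: fun_eq_iff)
  qed
  have img: "\<Phi> ` vecs l = (S \<rightarrow>\<^sub>E UNIV)"
  proof (rule card_subset_eq)
    show "finite (S \<rightarrow>\<^sub>E (UNIV :: 'k set))" using S(1) by (simp add: finite_PiE)
    show "\<Phi> ` vecs l \<subseteq> (S \<rightarrow>\<^sub>E UNIV)" by (auto simp: \<Phi>_def)
    show "card (\<Phi> ` vecs l) = card (S \<rightarrow>\<^sub>E (UNIV :: 'k set))"
      using S(1,2) by (simp add: card_image[OF inj] card_vecs card_PiE)
  qed
  have surj: "\<exists>P\<in>vecs l. \<forall>j\<in>S. lform l a j P = (f j :: 'k)" for f
  proof -
    have "restrict f S \<in> \<Phi> ` vecs l" unfolding img by simp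
    then obtain P where P: "P \<in> vecs l" "restrict f S = \<Phi> P" by blast
    have "lform l a j P = f j" if "j \<in> S" for j
      using fun_cong[OF P(2), of j] that by (simp add: \<Phi>_def)
    then show ?thesis using P(1) by blast
  qed
  then show "\<exists>P\<in>vecs l. \<forall>j\<in>S. lform l a j P = f j" .
  assume B: "B \<subseteq> S"
  have "\<Phi> ` common_zeros l a B = (\<Pi>\<^sub>E j\<in>S. if j \<in> B then {0} else UNIV)" (is "?L = ?R")
  proof
    show "?L \<subseteq> ?R" by (auto simp: \<Phi>_def common_zeros_def)
    show "?R \<subseteq> ?L"
    proof
      fix f assume f: "f \<in> ?R"
      then have "f \<in> (S \<rightarrow>\<^sub>E UNIV)" by (auto simp: PiE_def)
      then obtain P where P: "P \<in> vecs l" "f = \<Phi> P" unfolding img[symmetric] by blast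
      have "lform l a j P = 0" if "j \<in> B" for j
      proof -
        have "f j \<in> (if j \<in> B then {0} else UNIV)" using f B that by (intro PiE_mem[OF f]) blast
        then show ?thesis using P(2) B that by (auto simp: \<Phi>_def)
      qed
      then show "f \<in> ?L" using P by (auto simp: common_zeros_def)
    qed
  qed
  moreover have "inj_on \<Phi> (common_zeros l a B)"
    using inj by (rule inj_on_subset) (auto simp: common_zeros_def)
  ultimately have "card (common_zeros l a B :: (nat \<Rightarrow> 'k) set)
      = (\<Prod>j\<in>S. card (if j \<in> B then {0} else (UNIV :: 'k set)))"
    using card_image[of \<Phi> "common_zeros l a B"]
      card_PiE[OF S(1), of "\<lambda>j. if j \<in> B then {0} else (UNIV :: 'k set)"]
    by simp
  also have "\<dots> = (\<Prod>j\<in>S. if j \<in> B then 1 else card (UNIV :: 'k set))"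
    by (intro prod.cong) auto
  also have "\<dots> = card (UNIV :: 'k set) ^ card (S - B)"
    using S(1) by (simp add: prod.If_cases Diff_eq)
  also have "card (S - B) = l - card B"
    using S B by (simp add: card_Diff_subset finite_subset)
  finally show "card (common_zeros l a B :: (nat \<Rightarrow> 'k) set) = card (UNIV :: 'k set) ^ (l - card B)" .
qed

text \<open>An integral dependency with least positive leading coefficient D survives reduction: if p
  divided D, independence of the forms in S over the finite field would force p to divide all its
  coefficients.\<close>
lemma common_zeros_reduction:
  fixes l :: nat and a :: "nat \<Rightarrow> nat \<Rightarrow> int"
  assumes S: "finite S" "card S = l" "common_zeros l a S = {\<lambda>_. 0 :: rat}"
      "common_zeros l a S = {\<lambda>_. 0 :: 'k::{finite,field}}"
    and p: "prime p" "\<And>z. of_int z = (0::'k) \<longleftrightarrow> int p dvd z"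
    and B: "B' \<subseteq> S" "B' \<subseteq> B" "common_zeros l a B' = (common_zeros l a B :: (nat \<Rightarrow> rat) set)"
  shows "common_zeros l a B = (common_zeros l a B' :: (nat \<Rightarrow> 'k) set)"
proof
  show "common_zeros l a B \<subseteq> (common_zeros l a B' :: (nat \<Rightarrow> 'k) set)"
    using B(2) by (auto simp: common_zeros_def)
  have vanish: "lform l a i P = 0" if i: "i \<in> B" and P: "P \<in> common_zeros l a B'"
    for i and P :: "nat \<Rightarrow> 'k"
  proof -
    let ?R = "\<lambda>D::nat. 0 < D \<and> (\<exists>c. \<forall>m<l. int D * a i m = (\<Sum>j\<in>B'. c j * a j m))"
    have "lform l a i x = 0" if "x \<in> common_zeros l a B'" for x :: "nat \<Rightarrow> rat"
      using that i unfolding B(3) by (simp add: common_zeros_def)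
    from integer_relation[OF S(1-3) B(1) this]
    obtain D\<^sub>0 c\<^sub>0 where "D\<^sub>0 > 0" "\<forall>m<l. D\<^sub>0 * a i m = (\<Sum>j\<in>B'. c\<^sub>0 j * a j m)" by blast
    then have "?R (nat D\<^sub>0)" by auto
    then have R: "?R (LEAST D. ?R D)" by (rule LeastI)
    define D where "D = (LEAST D. ?R D)"
    obtain c where D: "D > 0" "\<And>m. m < l \<Longrightarrow> int D * a i m = (\<Sum>j\<in>B'. c j * a j m)"
      using R unfolding D_def by blast
    have rel: "of_int (int D) * lform l a i Q = (\<Sum>j\<in>B'. of_int (c j) * lform l a j Q)"
      for Q :: "nat \<Rightarrow> 'k"
    proof -
      have "of_int (int D) * lform l a i Q = (\<Sum>m<l. of_int (int D * a i m) * Q m)"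
        by (simp add: lform_def sum_distrib_left mult.assoc)
      also have "\<dots> = (\<Sum>m<l. of_int (\<Sum>j\<in>B'. c j * a j m) * Q m)"
        by (intro sum.cong) (simp_all only: D(2) lessThan_iff)
      also have "\<dots> = (\<Sum>j\<in>B'. of_int (c j) * lform l a j Q)"
        unfolding lform_def sum_distrib_left
        by (subst sum.swap) (simp add: sum_distrib_right mult.assoc)
      finally show ?thesis .
    qed
    have "\<not> int p dvd int D"
    proof
      assume pD: "int p dvd int D"
      have c: "int p dvd c j" if j: "j \<in> B'" for j
      proof -
        \<comment> \<open>At a dual point of \<open>j\<close> over the finite field the relation
          collapses to the single coefficient \<open>c j\<close>.\<close>
        obtain Q :: "nat \<Rightarrow> 'k" where Q: "\<forall>i\<in>S. lform l a i Q = (if i = j then 1 else 0)"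
          using lforms_surj[OF S(1,2,4), of "\<lambda>i. if i = j then 1 else 0"] by blast
        have "(0::'k) = (\<Sum>i\<in>B'. of_int (c i) * lform l a i Q)"
          unfolding rel[symmetric] using pD p(2)[of "int D"] by simp
        also have "\<dots> = (\<Sum>i\<in>B'. if i = j then of_int (c i) else 0)"
          using Q B(1) by (intro sum.cong) auto
        also have "\<dots> = of_int (c j)" using j finite_subset[OF B(1) S(1)] by simp
        finally show ?thesis using p(2) by simp
      qed
      obtain D' where D': "D = p * D'" using pD by (auto simp: int_dvd_int_iff)
      \<comment> \<open>Dividing the relation by \<open>p\<close> is exact and produces the smaller
        multiplier \<open>D'\<close>, against leastness of \<open>D\<close>.\<close>
      have "int D' * a i m = (\<Sum>j\<in>B'. (c j div int p) * a j m)" if "m < l" for m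
      proof -
        have "int p * (int D' * a i m) = (\<Sum>j\<in>B'. c j * a j m)"
          using D(2)[OF that] D' by (simp add: mult.assoc)
        also have "\<dots> = (\<Sum>j\<in>B'. int p * ((c j div int p) * a j m))"
          using c by (intro sum.cong refl) (simp flip: mult.assoc)
        also have "\<dots> = int p * (\<Sum>j\<in>B'. (c j div int p) * a j m)" by (simp add: sum_distrib_left)
        finally show ?thesis using prime_gt_0_nat[OF p(1)] by simp
      qed
      then have "?R D'" using D(1) D' by auto
      then have "D \<le> D'" unfolding D_def by (rule Least_le)
      then show False using D' D(1) prime_gt_1_nat[OF p(1)] by simp
    qed
    moreover have "of_int (int D) * lform l a i P = 0"
      unfolding rel using P by (simp add: common_zeros_def)
    ultimately show ?thesis using p(2)[of "int D"] by simp
  qed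
  show "common_zeros l a B' \<subseteq> (common_zeros l a B :: (nat \<Rightarrow> 'k) set)"
    using vanish by (auto simp: common_zeros_def)
qed

section \<open>Distinctness of the reduced hyperplanes and the final count\<close>

text \<open>The test points \<open>P\<close> lie on hyperplane \<open>j\<close> by construction;
  that the form \<open>i\<close> vanishes there says that a 2 by 2 minor of the two coefficient rows
  is 0 modulo p. With \<open>v\<close> inverse to \<open>a j k\<^sub>0\<close> modulo p, the factor
  is \<open>v * a i k\<^sub>0\<close>.\<close>

lemma hyperplane_subset_imp_scalar_multiple:
  fixes l :: nat and a :: "nat \<Rightarrow> nat \<Rightarrow> int"
  assumes p: "prime p" "\<And>z. of_int z = (0::'k::field) \<longleftrightarrow> int p dvd z"
    and k\<^sub>0: "k\<^sub>0 < l" "\<not> int p dvd a j k\<^sub>0"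
    and sub: "hyperplane l a j \<subseteq> (hyperplane l a i :: (nat \<Rightarrow> 'k) set)"
  shows "\<exists>c. \<forall>k<l. int p dvd a i k - c * a j k"
proof -
  have "coprime (int p) (a j k\<^sub>0)" using p(1) k\<^sub>0(2) by (intro prime_imp_coprime) simp_all
  then obtain u v where uv: "u * int p + v * a j k\<^sub>0 = 1"
    using bezout_int[of "int p" "a j k\<^sub>0"] by auto
  have "int p dvd a i k - (v * a i k\<^sub>0) * a j k" if k: "k < l" for k
  proof -
    define P :: "nat \<Rightarrow> 'k" where "P = (\<lambda>m. of_int (a j k\<^sub>0) * (if m = k then 1 else 0)
      - of_int (a j k) * (if m = k\<^sub>0 then 1 else 0))"
    have lf: "lform l a i' P = of_int (a j k\<^sub>0 * a i' k - a j k * a i' k\<^sub>0)" for i'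
      unfolding P_def lform_diff lform_scale by (simp add: lform_unit k k\<^sub>0(1))
    have "P \<in> hyperplane l a j"
      using k k\<^sub>0(1) lf[of j] by (auto simp: hyperplane_def P_def vecs_def)
    then have "lform l a i P = 0" using sub by (auto simp: hyperplane_def)
    then have "of_int (a j k\<^sub>0 * a i k - a j k * a i k\<^sub>0) = (0::'k)" unfolding lf .
    then have dvd: "int p dvd a j k\<^sub>0 * a i k - a j k * a i k\<^sub>0" unfolding p(2) .
    have "a i k - (v * a i k\<^sub>0) * a j k
        = (u * int p + v * a j k\<^sub>0) * a i k - (v * a i k\<^sub>0) * a j k" using uv by simp
    also have "\<dots> = int p * (u * a i k) + v * (a j k\<^sub>0 * a i k - a j k * a i k\<^sub>0)"
      by (simp add: algebra_simps)
    also have "int p dvd \<dots>" using dvd by (intro dvd_add dvd_mult[OF dvd]) simp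
    finally show ?thesis .
  qed
  then show ?thesis by blast
qed

text \<open>\<open>good_prime\<close> excludes the form with the smaller index being a multiple of
  the other, which fixes the inclusion to use. The coefficient of \<open>j\<close> prime to p comes
  from primitivity of the forms.\<close>

lemma inj_on_hyperplane:
  assumes "arrangement l n a" "good_prime l n a p"
    and p: "prime p" "\<And>z. of_int z = (0::'k::field) \<longleftrightarrow> int p dvd z"
  shows "inj_on (hyperplane l a :: nat \<Rightarrow> (nat \<Rightarrow> 'k) set) {..<n}"
proof -
  have neq: "hyperplane l a i \<noteq> (hyperplane l a j :: (nat \<Rightarrow> 'k) set)" if ij: "i < j" "j < n" for i j
  proof
    assume eq: "hyperplane l a i = (hyperplane l a j :: (nat \<Rightarrow> 'k) set)"
    have "prime (int p)" using p(1) by simp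
    then obtain k\<^sub>0 where "k\<^sub>0 < l" "\<not> int p dvd a j k\<^sub>0"
      using assms(1) ij(2) unfolding arrangement_def by blast
    from hyperplane_subset_imp_scalar_multiple[OF p this equalityD2[OF eq]]
    show False using assms(2) ij unfolding good_prime_def by blast
  qed
  show ?thesis
  proof (rule inj_onI)
    fix i j assume "i \<in> {..<n}" "j \<in> {..<n}" "hyperplane l a i = (hyperplane l a j :: (nat \<Rightarrow> 'k) set)"
    then show "i = j" using neq[of i j] neq[of j i] by (cases i j rule: linorder_cases) auto
  qed
qed

lemma hcount_eq_card:
  fixes P :: "nat \<Rightarrow> 'k::ring_1"
  assumes "inj_on (hyperplane l a :: nat \<Rightarrow> (nat \<Rightarrow> 'k) set) {..<n}" "P \<in> vecs l"
  shows "hcount l n a P = card {i. i < n \<and> lform l a i P = 0}"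
proof -
  have "{H \<in> hyperplane l a ` {..<n}. P \<in> H} = hyperplane l a ` {i. i < n \<and> lform l a i P = 0}"
    using assms(2) by (auto simp: hyperplane_def)
  moreover have "inj_on (hyperplane l a :: nat \<Rightarrow> (nat \<Rightarrow> 'k) set) {i. i < n \<and> lform l a i P = 0}"
    using assms(1) by (rule inj_on_subset) auto
  ultimately show ?thesis by (simp add: hcount_def card_image)
qed

lemma power_card_eq_sum_Pow:
  fixes u :: "'a::comm_semiring_1"
  assumes "finite Z"
  shows "(u + 1) ^ card Z = (\<Sum>B\<in>Pow Z. u ^ card B)"
  using prod_add[OF assms, of "\<lambda>_. u" "\<lambda>_. 1"] by simp

lemma rk_common_zeros: "rk l a B = l - qdim (common_zeros l a B)"
  by (simp add: rk_def common_zeros_eq)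

text \<open>Equality of the ranks over the two fields, phrased as a count of points because that is
  what the exchanged sum produces.\<close>

lemma card_common_zeros:
  fixes l n :: nat and a :: "nat \<Rightarrow> nat \<Rightarrow> int"
  assumes "essential l n a" "term_order l le" "arr_lucky l n a le p"
    and p: "prime p" "\<And>z. of_int z = (0::'k::{finite,field}) \<longleftrightarrow> int p dvd z"
    and B: "B \<subseteq> {..<n}"
  shows "card (common_zeros l a B :: (nat \<Rightarrow> 'k) set) = card (UNIV :: 'k set) ^ (l - rk l a B)"
proof -
  have ess: "common_zeros l a {..<n} = {\<lambda>_. 0 :: rat}"
    using assms(1) by (simp add: essential_def common_zeros_eq)
  have finB: "finite B" using B finite_subset by blast
  have "qdim (common_zeros l a {}) + card ({} :: nat set) = l"
    by (simp add: common_zeros_empty qdim_vecs)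
  from independent_subset_extension[OF finB finite.emptyI this]
  obtain B' where B': "B' \<subseteq> B" "qdim (common_zeros l a B') + card B' = l"
    "common_zeros l a B' = (common_zeros l a B :: (nat \<Rightarrow> rat) set)" by auto
  have finB': "finite B'" using B'(1) finB finite_subset by blast
  have un: "B' \<union> {..<n} = {..<n}" using B B'(1) by blast
  \<comment> \<open>The forms \<open>{..<n}\<close> have only the trivial common zero, so the
    completed independent set \<open>S\<close> has exactly \<open>l\<close> elements and luckiness
    applies to it.\<close>
  obtain S where S: "B' \<subseteq> S" "S \<subseteq> {..<n}" "qdim (common_zeros l a S) + card S = l"
    "common_zeros l a S = {\<lambda>_. 0 :: rat}"
    using independent_subset_extension[OF finite_lessThan[of n] finB' B'(2)] unfolding un ess by blast
  have finS: "finite S" using S(2) finite_subset by blast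
  have cardS: "card S = l" using S(3,4) by (simp add: qdim_zero)
  have rkS: "rk l a S = l" using S(4) by (simp add: rk_common_zeros qdim_zero)
  have lucky: "lucky l le (gen_ideal l (linpoly l a ` S)) p"
    using assms(3) S(2) cardS rkS unfolding arr_lucky_def by blast
  have S0: "common_zeros l a S = {\<lambda>_. 0 :: 'k}"
  proof
    have "P = (\<lambda>_. 0)" if "P \<in> common_zeros l a S" for P :: "nat \<Rightarrow> 'k"
      using that integer_relation_unit[OF finS cardS S(4)]
      by (intro lucky_common_zero[OF assms(2) lucky _ p(2)]) (auto simp: common_zeros_def)
    then show "common_zeros l a S \<subseteq> {\<lambda>_. 0 :: 'k}" by blast
    show "{\<lambda>_. 0 :: 'k} \<subseteq> common_zeros l a S" by (simp add: common_zeros_def vecs_def lform_zero)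
  qed
  have "rk l a B = card B'" using B'(2) by (simp add: rk_common_zeros flip: B'(3))
  then show ?thesis
    using common_zeros_reduction[OF finS cardS S(4) S0 p S(1) B'(1,3)]
      card_common_zeros_subset[OF finS cardS S0 S(1)] by simp
qed

theorem theorem4p17:
  fixes l n :: nat and a :: "nat \<Rightarrow> nat \<Rightarrow> int"
    and le :: "monom \<Rightarrow> monom \<Rightarrow> bool" and p e :: nat
  assumes "arrangement l n a" and "essential l n a"
    and "term_order l le"
    and "prime p" and "good_prime l n a p" and "arr_lucky l n a le p"
    and "e \<ge> 1" and "card (UNIV :: ('k::{finite,field}) set) = p ^ e"
  shows "coboundary_at l n a (int (p ^ e)) =
         (\<Sum>P\<in>(vecs l :: (nat \<Rightarrow> 'k) set). [:0, 1:] ^ hcount l n a P)"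
proof -
  have char: "of_int z = (0::'k) \<longleftrightarrow> int p dvd z" for z
    by (rule of_int_eq_zero_iff_dvd[OF assms(4,8)])
  let ?u = "[:-1, 1:] :: int poly"
  let ?Z = "\<lambda>P :: nat \<Rightarrow> 'k. {i. i < n \<and> lform l a i P = 0}"
  have rkA: "rk l a {..<n} = l"
    using assms(2) by (simp add: rk_def essential_def qdim_zero)
  have inj: "inj_on (hyperplane l a :: nat \<Rightarrow> (nat \<Rightarrow> 'k) set) {..<n}"
    by (rule inj_on_hyperplane[OF assms(1,5,4) char])
  have "(\<Sum>P\<in>(vecs l :: (nat \<Rightarrow> 'k) set). [:0, 1:] ^ hcount l n a P)
      = (\<Sum>P\<in>(vecs l :: (nat \<Rightarrow> 'k) set). (?u + 1) ^ card (?Z P))"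
    by (intro sum.cong) (simp_all add: hcount_eq_card[OF inj] one_pCons)
  also have "\<dots> = (\<Sum>P\<in>vecs l. \<Sum>B\<in>Pow (?Z P). ?u ^ card B)"
    by (intro sum.cong power_card_eq_sum_Pow) simp_all
  \<comment> \<open>\<open>B\<close> consists of hyperplanes through \<open>P\<close> exactly when
    \<open>P\<close> is a common zero of \<open>B\<close>; the indicator makes both index ranges
    independent, so the sums can be exchanged.\<close>
  also have "\<dots> = (\<Sum>P\<in>(vecs l :: (nat \<Rightarrow> 'k) set). \<Sum>B\<in>Pow {..<n}.
      if P \<in> common_zeros l a B then ?u ^ card B else 0)"
    by (intro sum.cong refl sum.mono_neutral_cong_left) (auto simp: common_zeros_def)
  also have "\<dots> = (\<Sum>B\<in>Pow {..<n}. \<Sum>P\<in>(vecs l :: (nat \<Rightarrow> 'k) set).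
      if P \<in> common_zeros l a B then ?u ^ card B else 0)"
    by (rule sum.swap)
  also have "\<dots> = (\<Sum>B\<in>Pow {..<n}. \<Sum>P\<in>(common_zeros l a B :: (nat \<Rightarrow> 'k) set). ?u ^ card B)"
    by (intro sum.cong refl sum.mono_neutral_cong_right finite_vecs) (auto simp: common_zeros_def)
  also have "\<dots> = (\<Sum>B\<in>Pow {..<n}. of_nat (card (common_zeros l a B :: (nat \<Rightarrow> 'k) set)) * ?u ^ card B)"
    by simp
  also have "\<dots> = (\<Sum>B\<in>Pow {..<n}. [:int (p ^ e):] ^ (l - rk l a B) * ?u ^ card B)"
  proof (intro sum.cong refl)
    fix B assume "B \<in> Pow {..<n}"
    then have "card (common_zeros l a B :: (nat \<Rightarrow> 'k) set) = (p ^ e) ^ (l - rk l a B)"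
      using card_common_zeros[OF assms(2,3,6,4) char] assms(8) by simp
    then have "of_nat (card (common_zeros l a B :: (nat \<Rightarrow> 'k) set))
        = (of_nat (p ^ e) :: int poly) ^ (l - rk l a B)" by (simp only: of_nat_power)
    then show "of_nat (card (common_zeros l a B :: (nat \<Rightarrow> 'k) set)) * ?u ^ card B
        = [:int (p ^ e):] ^ (l - rk l a B) * ?u ^ card B"
      by (simp only: of_nat_poly)
  qed
  finally show ?thesis by (simp add: coboundary_at_def rkA)
qed

end
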